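(* Let $I\subset\mathbb{R}$ be an interval, $\Omega\subset\mathbb{R}^n$ a bounded domain, and $s\in(0,1)$. Let $\{u^t\}_{t\in I}$ be a $C^2$ field in $\mathbb{R}^n$ satisfying $$|u^t(x)|+|\partial_t u^t(x)|\le C\quad\text{for all } x\in\mathbb{R}^n \text{ and } t\in I,$$ for some constant $C$. Consider the admissible functions $$\mathcal{A}_s=\{w\in C^0(\mathbb{R}^n)\cap L^\infty(\mathbb{R}^n) : \operatorname{graph} w\subset\mathcal{G}\},\qquad \mathcal{G}=\{(x,\lambda)\in\mathbb{R}^n\times\mathbb{R} : \lambda=u^t(x)\text{ for some } t\in I\}.$$ Given $t_0\in I$ and $F\in C^1(\mathbb{R})$, let $\mathcal{C}_{s,F}$ be the functional $$\mathcal{C}_{s,F}(w):=c_{n,s}\,\mathrm{P.V.}\iint_{Q(\Omega)}\int_{u^{t_0}(x)}^{w(x)}\frac{u^t(x)-u^t(y)}{|x-y|^{n+2s}}\bigg|_{t=t(x,\lambda)}\,d\lambda\,dx\,dy-\int_\Omega F(w(x))\,dx+\frac{c_{n,s}}{4}\iint_{Q(\Omega)}\frac{|u^{t_0}(x)-u^{t_0}(y)|^2}{|x-y|^{n+2s}}\,dx\,dy$$ defined for $w\in\mathcal{A}_s$, and let $$\mathcal{E}_{s,F}(w)=\frac{c_{n,s}}{4}\iint_{Q(\Omega)}\frac{|w(x)-w(y)|^2}{|x-y|^{n+2s}}\,dx\,dy-\int_\Omega F(w(x))\,dx.$$ Then: (a) $\mathcal{C}_{s,F}(u^{t_0})=\mathcal{E}_{s,F}(u^{t_0})$,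 and $\mathcal{C}_{s,F}(w)\le\mathcal{E}_{s,F}(w)$ for all $w\in\mathcal{A}_s$ with $w\equiv u^{t_0}$ in $\Omega^c$. (b) Assume in addition that $$(-\Delta)^s u^t-F'(u^t)\ge 0 \text{ in }\Omega\ \text{ for } t\ge t_0,\qquad (-\Delta)^s u^t-F'(u^t)\le 0\text{ in }\Omega\ \text{ for } t\le t_0$$ (with $t\in I$). Then $\mathcal{C}_{s,F}(u^{t_0})\le\mathcal{C}_{s,F}(w)$ for all $w\in\mathcal{A}_s$ with $w\equiv u^{t_0}$ in $\Omega^c$. In particular, $u^{t_0}$ minimizes $\mathcal{E}_{s,F}$ among functions $w\in\mathcal{A}_s$ such that $w\equiv u^{t_0}$ in $\Omega^c$. (c) Assume in addition (to the hypotheses preceding (a)) that $\{u^t\}_{t\in I}$ is a field of extremals in $\Omega$, that is, $$(-\Delta)^s u^t-F'(u^t)=0\text{ in }\Omega\ \text{ for all } t\in I.$$ Then $\mathcal{C}_{s,F}(w)=\mathcal{C}_{s,F}(\widetilde w)$ for all $w,\widetilde w\in\mathcal{A}_s$ with $w\equiv\widetilde w\equiv u^{t_0}$ in $\Omega^c$. Therefore $\mathcal{C}_{s,F}$ is a calibration for $\mathcal{E}_{s,F}$ and $u^{t_0}$. As a consequence, for every $t\in I$, the extremal $u^t$ minimizes $\mathcal{E}_{s,F}$ among functions $w\in\mathcal{A}_s$ such that $w\equiv u^t$ in $\Omega^c$.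
   Context: $\Omega^c=\mathbb{R}^n\setminus\Omega$ and $Q(\Omega):=(\mathbb{R}^n\times\mathbb{R}^n)\setminus(\Omega^c\times\Omega^c)$. The fractional Laplacian is $(-\Delta)^su(x)=c_{n,s}\,\mathrm{P.V.}\int_{\mathbb{R}^n}\frac{u(x)-u(y)}{|x-y|^{n+2s}}\,dy$, where $c_{n,s}$ is a positive normalizing constant (the same one throughout). $C^2$ field in $\mathbb{R}^n$: a family $\{u^t\}_{t\in I}$ of functions $u^t:\mathbb{R}^n\to\mathbb{R}$, indexed by an interval $I\subset\mathbb{R}$ (not necessarily bounded nor open), such that $(x,t)\mapsto u^t(x)$ is $C^2$ in $\mathbb{R}^n\times I$ and, for each $x\in\mathbb{R}^n$, the function $t\mapsto u^t(x)$ is $C^1$ and (strictly) increasing in $I$. Leaf-parameter function: $t:\mathcal{G}\to I$, $(x,\lambda)\mapsto t(x,\lambda)$, is the unique value determined by $u^{t(x,\lambda)}(x)=\lambda$. The notation $|_{t=t(x,\lambda)}$ means evaluation at this parameter. Principal value in $\mathcal{C}_{s,F}$: it is understood as $\lim_{\varepsilon\downarrow0}$ of the same integral taken over $Q(\Omega)\setminus\{|x-y|<\varepsilon\}$. For $w\equiv u^{t_0}$ in $\Omega^c$ the first term of $\mathcal{C}_{s,F}(w)$ equals $\int_\Omega\int_{u^{t_0}(x)}^{w(x)}(-\Delta)^su^t(x)|_{t=t(x,\lambda)}\,d\lambda\,dx$. Calibration: given a functional $\mathcal{E}$ on a set $\mathcal{A}$ of admissible functions and $u\in\mathcal{A}$,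 a functional $\mathcal{C}:\mathcal{A}\to\mathbb{R}$ is a calibration for $\mathcal{E}$ and $u$ if $\mathcal{C}(u)=\mathcal{E}(u)$; $\mathcal{C}(w)\le\mathcal{E}(w)$ for all $w\in\mathcal{A}$ with the same Dirichlet condition as $u$; and $\mathcal{C}(w)=\mathcal{C}(\widetilde w)$ for all $w,\widetilde w\in\mathcal{A}$ with the same Dirichlet condition as $u$. Here, having the same Dirichlet condition as $u$ means coinciding with $u$ in $\Omega^c$. *)

theory Defs
  imports "HOL-Analysis.Analysis"
begin

text \<open>
  The sets below need not be open (in the application they are \<open>\<real>\<^sup>n \<times> I\<close> or \<open>I\<close>, where the interval
  \<open>I\<close> may contain endpoints), so derivatives are taken within the set; at an endpoint of \<open>I\<close> they are
  one-sided in \<open>t\<close>.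
\<close>

definition C1_on :: "real set \<Rightarrow> (real \<Rightarrow> real) \<Rightarrow> bool" where
  "C1_on S f \<longleftrightarrow>
     (\<exists>f'. (\<forall>t\<in>S. (f has_real_derivative f' t) (at t within S)) \<and> continuous_on S f')"

definition C2_on :: "'a::real_normed_vector set \<Rightarrow> ('a \<Rightarrow> real) \<Rightarrow> bool" where
  "C2_on S f \<longleftrightarrow>
     (\<exists>(f' :: 'a \<Rightarrow> 'a \<Rightarrow>\<^sub>L real) (f'' :: 'a \<Rightarrow> 'a \<Rightarrow>\<^sub>L ('a \<Rightarrow>\<^sub>L real)).
        (\<forall>z\<in>S. (f has_derivative blinfun_apply (f' z)) (at z within S)) \<and>
        (\<forall>z\<in>S. (f' has_derivative blinfun_apply (f'' z)) (at z within S)) \<and>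
        continuous_on S f'')"

definition C2_field :: "real set \<Rightarrow> (real \<Rightarrow> real ^ 'n \<Rightarrow> real) \<Rightarrow> bool" where
  "C2_field I u \<longleftrightarrow>
     C2_on (UNIV \<times> I) (\<lambda>(x, t). u t x) \<and>
     (\<forall>x. C1_on I (\<lambda>t. u t x) \<and> strict_mono_on I (\<lambda>t. u t x))"

definition field_region :: "real set \<Rightarrow> (real \<Rightarrow> real ^ 'n \<Rightarrow> real) \<Rightarrow> ((real ^ 'n) \<times> real) set" where
  "field_region I u = {(x, l). \<exists>t\<in>I. l = u t x}"

definition leaf_param ::
    "real set \<Rightarrow> (real \<Rightarrow> real ^ 'n \<Rightarrow> real) \<Rightarrow> real ^ 'n \<Rightarrow> real \<Rightarrow> real" where
  "leaf_param I u x l = (THE t. t \<in> I \<and> u t x = l)"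

definition L_infinity :: "(real ^ 'n \<Rightarrow> real) set" where
  "L_infinity = {w. w \<in> borel_measurable lborel \<and> (\<exists>M. AE x in lborel. \<bar>w x\<bar> \<le> M)}"

definition admissible ::
    "real set \<Rightarrow> (real \<Rightarrow> real ^ 'n \<Rightarrow> real) \<Rightarrow> (real ^ 'n \<Rightarrow> real) set" where
  "admissible I u =
     {w. continuous_on UNIV w \<and> w \<in> L_infinity \<and> (\<forall>x. (x, w x) \<in> field_region I u)}"

definition same_dirichlet ::
    "(real ^ 'n) set \<Rightarrow> (real ^ 'n \<Rightarrow> real) \<Rightarrow> (real ^ 'n \<Rightarrow> real) \<Rightarrow> bool" where
  "same_dirichlet \<Omega> w v \<longleftrightarrow> (\<forall>x\<in>- \<Omega>. w x = v x)"

definition Q_region :: "(real ^ 'n) set \<Rightarrow> ((real ^ 'n) \<times> (real ^ 'n)) set" where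
  "Q_region \<Omega> = UNIV - (- \<Omega>) \<times> (- \<Omega>)"

text \<open>
  In all definitions below \<open>c\<close> stands for the normalizing constant \<open>c\<^bsub>n,s\<^esub>\<close>, of which only
  positivity matters. On the diagonal \<open>x = y\<close>, a null set, the quotients are \<open>0\<close> by the convention
  on division by \<open>0\<close>.
\<close>

definition frac_laplacian ::
    "real \<Rightarrow> real \<Rightarrow> (real ^ 'n \<Rightarrow> real) \<Rightarrow> real ^ 'n \<Rightarrow> real" where
  "frac_laplacian c s v x =
     c * Lim (at_right 0) (\<lambda>\<epsilon>. LINT y:{y. \<epsilon> \<le> norm (x - y)}|lborel.
           (v x - v y) / norm (x - y) powr (real CARD('n) + 2 * s))"

text \<open>
  The Gagliardo part of the energy of an admissible function may be infinite, so the energy takes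
  values in \<open>(-\<infinity>, \<infinity>]\<close>.
\<close>

definition energy ::
    "real \<Rightarrow> real \<Rightarrow> (real \<Rightarrow> real) \<Rightarrow> (real ^ 'n) set \<Rightarrow> (real ^ 'n \<Rightarrow> real) \<Rightarrow> ereal" where
  "energy c s F \<Omega> w =
     ereal (c / 4) *
       enn2ereal (\<integral>\<^sup>+(x, y)\<in>Q_region \<Omega>.
         ennreal (\<bar>w x - w y\<bar>\<^sup>2 / norm (x - y) powr (real CARD('n) + 2 * s)) \<partial>lborel)
     - ereal (LINT x:\<Omega>|lborel. F (w x))"

definition leaf_quotient ::
    "real \<Rightarrow> real set \<Rightarrow> (real \<Rightarrow> real ^ 'n \<Rightarrow> real) \<Rightarrow> real ^ 'n \<Rightarrow> real ^ 'n \<Rightarrow> real \<Rightarrow> real" where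
  "leaf_quotient s I u x y l =
     (let t = leaf_param I u x l
      in (u t x - u t y) / norm (x - y) powr (real CARD('n) + 2 * s))"

definition inner_integral ::
    "real \<Rightarrow> real set \<Rightarrow> (real \<Rightarrow> real ^ 'n \<Rightarrow> real) \<Rightarrow> real \<Rightarrow> (real ^ 'n \<Rightarrow> real)
      \<Rightarrow> real ^ 'n \<Rightarrow> real ^ 'n \<Rightarrow> real" where
  "inner_integral s I u t0 w x y =
     (LBINT l=ereal (u t0 x)..ereal (w x). leaf_quotient s I u x y l)"

definition Q_trunc :: "(real ^ 'n) set \<Rightarrow> real \<Rightarrow> ((real ^ 'n) \<times> (real ^ 'n)) set" where
  "Q_trunc \<Omega> \<epsilon> = Q_region \<Omega> - {(x, y). norm (x - y) < \<epsilon>}"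

definition trunc_integral ::
    "real \<Rightarrow> real set \<Rightarrow> (real ^ 'n) set \<Rightarrow> (real \<Rightarrow> real ^ 'n \<Rightarrow> real) \<Rightarrow> real \<Rightarrow> (real ^ 'n \<Rightarrow> real)
      \<Rightarrow> real \<Rightarrow> real" where
  "trunc_integral s I \<Omega> u t0 w \<epsilon> =
     (LINT (x, y):Q_trunc \<Omega> \<epsilon>|lborel. inner_integral s I u t0 w x y)"

definition calib_functional ::
    "real \<Rightarrow> real \<Rightarrow> (real \<Rightarrow> real) \<Rightarrow> real set \<Rightarrow> (real ^ 'n) set \<Rightarrow> (real \<Rightarrow> real ^ 'n \<Rightarrow> real)
      \<Rightarrow> real \<Rightarrow> (real ^ 'n \<Rightarrow> real) \<Rightarrow> real" where
  "calib_functional c s F I \<Omega> u t0 w =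
     c * Lim (at_right 0) (trunc_integral s I \<Omega> u t0 w)
     - (LINT x:\<Omega>|lborel. F (w x))
     + c / 4 * (LINT (x, y):Q_region \<Omega>|lborel.
         \<bar>u t0 x - u t0 y\<bar>\<^sup>2 / norm (x - y) powr (real CARD('n) + 2 * s))"

text \<open>
  Both \<^const>\<open>Lim\<close> and the Bochner integral are total functions. The following predicate states that
  every integral and the principal value in \<^const>\<open>calib_functional\<close> exist, so that
  its value at \<open>w\<close> is a genuine real number.
\<close>

definition calib_well_defined ::
    "real \<Rightarrow> (real \<Rightarrow> real) \<Rightarrow> real set \<Rightarrow> (real ^ 'n) set \<Rightarrow> (real \<Rightarrow> real ^ 'n \<Rightarrow> real)
      \<Rightarrow> real \<Rightarrow> (real ^ 'n \<Rightarrow> real) \<Rightarrow> bool" where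
  "calib_well_defined s F I \<Omega> u t0 w \<longleftrightarrow>
     (\<forall>x y. interval_lebesgue_integrable lborel (ereal (u t0 x)) (ereal (w x))
        (leaf_quotient s I u x y)) \<and>
     (\<forall>\<epsilon>>0. set_integrable lborel (Q_trunc \<Omega> \<epsilon>) (\<lambda>(x, y). inner_integral s I u t0 w x y)) \<and>
     (\<exists>L. (trunc_integral s I \<Omega> u t0 w \<longlongrightarrow> L) (at_right 0)) \<and>
     set_integrable lborel \<Omega> (\<lambda>x. F (w x)) \<and>
     set_integrable lborel (Q_region \<Omega>)
       (\<lambda>(x, y). \<bar>u t0 x - u t0 y\<bar>\<^sup>2 / norm (x - y) powr (real CARD('n) + 2 * s))"

definition is_calibration ::
    "(real ^ 'n) set \<Rightarrow> (real ^ 'n \<Rightarrow> real) set \<Rightarrow> ((real ^ 'n \<Rightarrow> real) \<Rightarrow> ereal)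
      \<Rightarrow> (real ^ 'n \<Rightarrow> real) \<Rightarrow> ((real ^ 'n \<Rightarrow> real) \<Rightarrow> real) \<Rightarrow> bool" where
  "is_calibration \<Omega> A E v C \<longleftrightarrow>
     v \<in> A \<and>
     ereal (C v) = E v \<and>
     (\<forall>w\<in>A. same_dirichlet \<Omega> w v \<longrightarrow> ereal (C w) \<le> E w) \<and>
     (\<forall>w\<in>A. \<forall>w'\<in>A. same_dirichlet \<Omega> w v \<longrightarrow> same_dirichlet \<Omega> w' v \<longrightarrow> C w = C w')"

end

theory Submission
  imports Defs
begin

text \<open>
  For fixed \<open>y\<close>, write \<open>h(x, l)\<close> for the value \<open>u\<^sup>t(y)\<close> at \<open>t = t(x, l)\<close>. Up to the singular kernel, the inner
  integral of the calibration at \<open>(x, y)\<close> is \<open>\<integral> (l - h(x, l)) dl\<close> over \<open>l\<close> between \<open>u\<^bsup>t0\<^esup>(x)\<close> and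
  \<open>w(x)\<close>. Two ways of reading the resulting double integral give the whole result.

  \<^emph>\<open>Pairing \<open>(x, y)\<close> with \<open>(y, x)\<close>\<close> gives the comparison with the energy. As long as both points move
  along the same leaf parameter, the two inner integrals add up to the integral of
  \<open>d/dt (u\<^sup>t(x) - u\<^sup>t(y))\<^sup>2 / 2\<close> (\<open>gap_integral_diagonal\<close>). When \<open>w(x)\<close> and \<open>w(y)\<close> lie on different leaves,
  the remaining piece has an integrand monotone in the leaf parameter, and freezing it at the first
  leaf only increases the integral (\<open>gap_integral_le\<close>). Together this is a Young inequality
  (\<open>gap_integral_young\<close>): the symmetrized inner integral is at most
  \<open>((w(x) - w(y))\<^sup>2 - (u\<^bsup>t0\<^esup>(x) - u\<^bsup>t0\<^esup>(y))\<^sup>2) / 2\<close>. Integrating it off the diagonal and letting the truncation tend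
  to zero proves part (a) (\<open>calib_functional_le_energy\<close>).

  \<^emph>\<open>Integrating in \<open>y\<close> first\<close> gives the sign conditions. For fixed \<open>(x, l)\<close> the \<open>y\<close>-integral is the
  truncated fractional Laplacian of the leaf through \<open>(x, l)\<close>. The parameters of all leaves met by the
  region between the graphs of \<open>u\<^bsup>t0\<^esup>\<close> and \<open>w\<close> over \<open>\<Omega>\<close> lie in a compact subset of \<open>I\<close>, because the leaf
  parameter is continuous up to the end points of \<open>I\<close> (\<open>continuous_leaf_param\<close>); hence second
  differences of these leaves are uniformly bounded by a multiple of \<open>min(1, |z|\<^sup>2)\<close>, and dominated
  convergence identifies the principal value (\<open>trunc_integral_tendsto\<close>). Since \<open>F(w) - F(u\<^bsup>t0\<^esup>)\<close> is the
  integral of \<open>F'\<close> over the same range of \<open>l\<close>, the difference of the calibration at \<open>w\<close> and at \<open>u\<^bsup>t0\<^esup>\<close> is the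
  integral of \<open>(-\<Delta>)\<^sup>s u\<^sup>t - F'(u\<^sup>t)\<close> over the region between the two graphs, counted with the sign of
  \<open>w - u\<^bsup>t0\<^esup>\<close> (\<open>calib_functional_minus_base\<close>). Under the sign hypotheses it is nonnegative, and for a field
  of extremals it vanishes; combined with (a) this yields (b) and (c).
\<close>

section \<open>Integration lemmas\<close>

text \<open>
  The kernel of the fractional Laplacian multiplied by \<open>min 1 ((norm z)\<^sup>2)\<close>, which bounds, up to a
  constant, the second differences of a bounded \<open>C\<^sup>2\<close> function at a point; every singular integral below
  is dominated by it.
\<close>

definition levy_weight :: "real \<Rightarrow> 'a::euclidean_space \<Rightarrow> real" where
  "levy_weight s z = min 1 ((norm z)\<^sup>2) / norm z powr (real DIM('a) + 2 * s)"

lemma levy_weight_nonneg: "0 \<le> levy_weight s z"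
  by (simp add: levy_weight_def)

lemma borel_measurable_levy_weight [measurable]: "levy_weight s \<in> borel_measurable borel"
  unfolding levy_weight_def[abs_def] by measurable

lemma dyadic_bracket_small:
  fixes r :: real
  assumes "0 < r" "r \<le> 1"
  obtains k :: nat where "(1/2) ^ Suc k < r" "r \<le> (1/2) ^ k"
proof -
  obtain n where "(1/2::real) ^ n < r"
    using real_arch_pow_inv[of r "1/2"] assms by auto
  then obtain k where "\<forall>i\<le>k. \<not> (1/2::real) ^ i < r" "(1/2::real) ^ Suc k < r"
    using ex_least_nat_less[of "\<lambda>k. (1/2::real) ^ k < r" n] assms by auto
  then show ?thesis using that[of k] by force
qed

lemma dyadic_bracket_large:
  fixes r :: real
  assumes "1 \<le> r"
  obtains k :: nat where "2 ^ k \<le> r" "r < 2 ^ Suc k"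
proof -
  obtain n where "r < (2::real) ^ n"
    using real_arch_pow[of 2 r] by auto
  then obtain k where "\<forall>i\<le>k. \<not> r < (2::real) ^ i" "r < (2::real) ^ Suc k"
    using ex_least_nat_less[of "\<lambda>k. r < (2::real) ^ k" n] assms by auto
  then show ?thesis using that[of k] by force
qed

text \<open>
  On dyadic shells the weight is comparable to a constant, so it is dominated by a series of
  multiples of indicators of balls. The volumes of the balls turn the two halves of the series into
  geometric series with ratios \<open>(1/2) powr (2 - 2 * s)\<close> near the origin and \<open>(1/2) powr (2 * s)\<close> near
  infinity, which is where the two bounds on \<open>s\<close> enter.
\<close>

lemma integrable_levy_weight:
  assumes s: "0 < s" "s < 1"
  shows "integrable lborel (levy_weight s :: 'a::euclidean_space \<Rightarrow> real)"
proof -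
  define n where "n = DIM('a)"
  define p where "p = real n + 2 * s"
  define V where "V = unit_ball_vol (real n)"
  have V: "0 \<le> V" by (simp add: V_def)
  have p: "0 \<le> p" using s by (simp add: p_def)
  define d :: "nat \<Rightarrow> real" where "d k = (1/2) ^ k" for k
  define D :: "nat \<Rightarrow> real" where "D k = 2 ^ k" for k
  have d: "0 < d k" and D: "0 < D k" for k by (simp_all add: d_def D_def)
  define A where "A k = (d k)\<^sup>2 / (d k / 2) powr p" for k
  define B where "B k = 1 / D k powr p" for k
  have A0: "0 \<le> A k" and B0: "0 \<le> B k" for k by (simp_all add: A_def B_def)
  define g :: "nat \<Rightarrow> 'a \<Rightarrow> ennreal" where
    "g k z = ennreal (A k) * indicator (cball 0 (d k)) z + ennreal (B k) * indicator (ball 0 (2 * D k)) z"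
    for k z
  have bound: "ennreal (levy_weight s z) \<le> (\<Sum>k. g k z)" for z :: 'a
  proof -
    have "\<exists>k. ennreal (levy_weight s z) \<le> g k z"
    proof (cases "z = 0")
      case True
      then show ?thesis by (auto simp: levy_weight_def)
    next
      case False
      define r where "r = norm z"
      have r: "0 < r" using False by (simp add: r_def)
      show ?thesis
      proof (cases "r \<le> 1")
        case True
        then obtain k where k: "d (Suc k) < r" "r \<le> d k"
          using dyadic_bracket_small[OF r] unfolding d_def by metis
        have dk: "d k / 2 < r" using k(1) by (simp add: d_def)
        have "levy_weight s z \<le> r\<^sup>2 / r powr p"
          by (simp add: levy_weight_def r_def p_def n_def divide_right_mono)
        also have "\<dots> \<le> A k"
          unfolding A_def using r dk k(2) d[of k] p
          by (intro frac_le power_mono powr_mono2) auto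
        finally have "ennreal (levy_weight s z) \<le> ennreal (A k)" by (rule ennreal_leI)
        also have "\<dots> \<le> g k z" using k(2) by (simp add: g_def r_def)
        finally show ?thesis ..
      next
        case False
        then have "1 \<le> r" by simp
        then obtain k where k: "D k \<le> r" "r < D (Suc k)"
          using dyadic_bracket_large[of r] unfolding D_def by metis
        have "levy_weight s z \<le> 1 / r powr p"
          by (simp add: levy_weight_def r_def p_def n_def divide_right_mono)
        also have "\<dots> \<le> B k"
          unfolding B_def using r k(1) D[of k] p
          by (intro frac_le powr_mono2) auto
        finally have "ennreal (levy_weight s z) \<le> ennreal (B k)" by (rule ennreal_leI)
        also have "\<dots> \<le> g k z" using k(2) by (simp add: g_def r_def D_def)
        finally show ?thesis ..
      qed
    qed
    then obtain k where "ennreal (levy_weight s z) \<le> g k z" ..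
    also have "\<dots> = (\<Sum>i\<in>{k}. g i z)" by simp
    also have "\<dots> \<le> (\<Sum>k. g k z)" by (rule sum_le_suminf) auto
    finally show ?thesis .
  qed
  have [measurable]: "cball (0::'a) (d k) \<in> sets borel" "ball (0::'a) (2 * D k) \<in> sets borel" for k
    by simp_all
  have [measurable]: "g k \<in> borel_measurable lborel" for k
    unfolding g_def[abs_def] by measurable
  have gint: "(\<integral>\<^sup>+z. g k z \<partial>lborel)
      = ennreal (2 powr p * V * ((1/2) powr (2 - 2 * s)) ^ k + V * 2 ^ n * ((1/2) powr (2 * s)) ^ k)" for k
  proof -
    have dn: "d k powr real n = d k ^ n" "D k powr real n = D k ^ n"
      using d[of k] D[of k] by (simp_all add: powr_realpow)
    have d2: "d k powr 2 = (d k)\<^sup>2"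
      using d[of k] powr_realpow[of "d k" 2] by simp
    have e1: "A k * (V * d k ^ n) = 2 powr p * V * ((1/2) powr (2 - 2 * s)) ^ k"
    proof -
      have "A k * (V * d k ^ n) = 2 powr p * V * (d k powr 2 * d k powr real n / d k powr p)"
        using d[of k] by (simp add: A_def powr_divide dn d2)
      also have "d k powr 2 * d k powr real n / d k powr p = d k powr (2 + real n - p)"
        by (simp add: powr_add powr_diff)
      also have "2 + real n - p = 2 - 2 * s" by (simp add: p_def)
      also have "d k powr (2 - 2 * s) = ((1/2) powr (2 - 2 * s)) ^ k"
        by (simp add: d_def powr_realpow[symmetric] powr_powr mult.commute)
      finally show ?thesis .
    qed
    have e2: "B k * (V * (2 * D k) ^ n) = V * 2 ^ n * ((1/2) powr (2 * s)) ^ k"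
    proof -
      have "B k * (V * (2 * D k) ^ n) = V * 2 ^ n * (D k powr real n / D k powr p)"
        by (simp add: B_def dn power_mult_distrib)
      also have "D k powr real n / D k powr p = D k powr (real n - p)"
        by (simp add: powr_diff)
      also have "real n - p = - (2 * s)" by (simp add: p_def)
      also have "D k powr (- (2 * s)) = ((1/2) powr (2 * s)) ^ k"
        by (simp add: D_def powr_realpow[symmetric] powr_powr powr_divide powr_minus_divide mult.commute)
      finally show ?thesis .
    qed
    have "(\<integral>\<^sup>+z. g k z \<partial>lborel) = ennreal (A k) * ennreal (V * d k ^ n) + ennreal (B k) * ennreal (V * (2 * D k) ^ n)"
      unfolding g_def using d[of k] D[of k]
      by (subst nn_integral_add) (auto simp: nn_integral_cmult_indicator emeasure_cball emeasure_ball V_def n_def)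
    also have "\<dots> = ennreal (A k * (V * d k ^ n) + B k * (V * (2 * D k) ^ n))"
      using A0[of k] B0[of k] V d[of k] D[of k] by (simp add: ennreal_mult'[symmetric] ennreal_plus[symmetric] del: ennreal_plus)
    finally show ?thesis unfolding e1 e2 .
  qed
  have q: "0 \<le> (1/2::real) powr (2 - 2 * s)" "(1/2::real) powr (2 - 2 * s) < 1"
     "0 \<le> (1/2::real) powr (2 * s)" "(1/2::real) powr (2 * s) < 1"
    using s powr_less_mono2[of "2 - 2 * s" "1/2" 1] powr_less_mono2[of "2 * s" "1/2" 1] by simp_all
  have "(\<integral>\<^sup>+z. ennreal (levy_weight s z) \<partial>(lborel :: 'a measure)) \<le> (\<integral>\<^sup>+z. (\<Sum>k. g k z) \<partial>lborel)"
    by (intro nn_integral_mono bound)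
  also have "\<dots> = (\<Sum>k. \<integral>\<^sup>+z. g k z \<partial>lborel)"
    by (rule nn_integral_suminf) measurable
  also have "\<dots> < \<infinity>"
    unfolding gint
  proof (rule suminf_ennreal2[THEN ord_eq_less_trans])
    show "summable (\<lambda>k. 2 powr p * V * ((1/2) powr (2 - 2 * s)) ^ k + V * 2 ^ n * ((1/2) powr (2 * s)) ^ k)"
      using q by (intro summable_add summable_mult summable_geometric) auto
  qed (use V in auto)
  finally show ?thesis
    by (intro integrableI_nonneg) (auto simp: levy_weight_nonneg)
qed

lemma distr_lborel_isometry:
  fixes x :: "'a::euclidean_space"
  assumes "\<bar>\<sigma>\<bar> = 1"
  shows "distr lborel borel (\<lambda>z. x + \<sigma> *\<^sub>R z) = (lborel :: 'a measure)"
proof -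
  have "\<sigma> \<noteq> 0" using assms by auto
  from lborel_affine[OF this, of x] show ?thesis
    using assms by (simp add: density_1)
qed

lemma lborel_integral_shift_reflect:
  fixes f :: "'a::euclidean_space \<Rightarrow> real"
  assumes [measurable]: "f \<in> borel_measurable borel"
  shows "(\<integral>z. f (x + z) \<partial>lborel) = (\<integral>y. f y \<partial>lborel)"
    and "(\<integral>z. f (x - z) \<partial>lborel) = (\<integral>y. f y \<partial>lborel)"
    and "integrable lborel (\<lambda>z. f (x - z)) \<longleftrightarrow> integrable lborel f"
proof -
  have i: "(\<integral>z. f (x + \<sigma> *\<^sub>R z) \<partial>lborel) = (\<integral>y. f y \<partial>lborel)" 
   and j: "integrable lborel (\<lambda>z. f (x + \<sigma> *\<^sub>R z)) \<longleftrightarrow> integrable lborel f" if "\<bar>\<sigma>\<bar> = 1" for \<sigma>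
    using that integral_distr[of "\<lambda>z. x + \<sigma> *\<^sub>R z" lborel borel f]
      integrable_distr_eq[of "\<lambda>z. x + \<sigma> *\<^sub>R z" lborel borel f]
    by (simp_all add: distr_lborel_isometry)
  show "(\<integral>z. f (x + z) \<partial>lborel) = (\<integral>y. f y \<partial>lborel)"
    "(\<integral>z. f (x - z) \<partial>lborel) = (\<integral>y. f y \<partial>lborel)"
    "integrable lborel (\<lambda>z. f (x - z)) \<longleftrightarrow> integrable lborel f"
    using i[of 1] i[of "-1"] j[of 1] j[of "-1"] by simp_all
qed

text \<open>
  Measurability of the limit is a conclusion here: the limits below are integrals of fractional
  Laplacians, whose measurability is easiest to see from their truncations.
\<close>

lemma dominated_at_right_zero:
  fixes f :: "real \<Rightarrow> 'a \<Rightarrow> real"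
  assumes meas: "\<And>\<epsilon>. 0 < \<epsilon> \<Longrightarrow> f \<epsilon> \<in> borel_measurable M"
    and lim: "\<And>x. x \<in> space M \<Longrightarrow> ((\<lambda>\<epsilon>. f \<epsilon> x) \<longlongrightarrow> g x) (at_right 0)"
    and bnd: "\<And>\<epsilon> x. 0 < \<epsilon> \<Longrightarrow> x \<in> space M \<Longrightarrow> \<bar>f \<epsilon> x\<bar> \<le> b x"
    and b: "integrable M b"
  shows "integrable M g" "((\<lambda>\<epsilon>. integral\<^sup>L M (f \<epsilon>)) \<longlongrightarrow> integral\<^sup>L M g) (at_right 0)"
proof -
  have seq: "(\<lambda>i. f (X i) x) \<longlonglongrightarrow> g x"
    if "x \<in> space M" "X \<longlonglongrightarrow> 0" "\<And>i. 0 < X i" for X :: "nat \<Rightarrow> real" and x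
  proof -
    have "filterlim X (at_right 0) sequentially"
      using that by (intro tendsto_imp_filterlim_at_right) (auto intro: always_eventually)
    from filterlim_compose[OF lim[OF that(1)] this] show ?thesis .
  qed
  have g: "g \<in> borel_measurable M"
    by (rule borel_measurable_LIMSEQ_real[of _ "\<lambda>i. f (1 / real (Suc i))"])
       (use LIMSEQ_Suc[OF lim_1_over_n] in \<open>auto intro!: seq meas simp del: of_nat_Suc\<close>)
  have S: "integrable M g \<and> (\<lambda>i. integral\<^sup>L M (f (X i))) \<longlonglongrightarrow> integral\<^sup>L M g"
    if X: "X \<longlonglongrightarrow> 0" "\<And>i. 0 < X i" for X :: "nat \<Rightarrow> real"
    using integral_dominated_convergence[of g M "\<lambda>i. f (X i)" b]
      integrable_dominated_convergence[of g M "\<lambda>i. f (X i)" b] X g b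
    by (auto intro!: meas bnd seq AE_I2)
  show "integrable M g"
    using S[of "\<lambda>i. 1 / real (Suc i)"] LIMSEQ_Suc[OF lim_1_over_n] by (auto simp del: of_nat_Suc)
  show "((\<lambda>\<epsilon>. integral\<^sup>L M (f \<epsilon>)) \<longlongrightarrow> integral\<^sup>L M g) (at_right 0)"
    unfolding tendsto_at_iff_sequentially comp_def using S by auto
qed

lemma measurable_lborel_pair:
  "f \<in> borel_measurable (borel \<Otimes>\<^sub>M borel) \<Longrightarrow>
    f \<in> borel_measurable (lborel :: ('a::euclidean_space \<times> 'b::euclidean_space) measure)"
  by (simp add: borel_prod)

lemma integrable_lborel_pair:
  fixes f :: "'a::euclidean_space \<times> 'b::euclidean_space \<Rightarrow> real"
  assumes [measurable]: "f \<in> borel_measurable borel"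
    and "integrable lborel (\<lambda>x. \<integral>y. \<bar>f (x, y)\<bar> \<partial>lborel)"
    and "\<And>x. integrable lborel (\<lambda>y. f (x, y))"
  shows "integrable lborel f"
proof -
  have "f \<in> borel_measurable (lborel \<Otimes>\<^sub>M lborel)" by (simp add: lborel_prod)
  from lborel_pair.Fubini_integrable[OF this] assms show ?thesis
    by (simp add: lborel_prod)
qed

lemma integrable_lborel_product:
  fixes f :: "'a::euclidean_space \<Rightarrow> real" and g :: "'b::euclidean_space \<Rightarrow> real"
  assumes f: "integrable lborel f" and g: "integrable lborel g"
  shows "integrable lborel (\<lambda>(x, y). f x * g y)"
proof (rule integrable_lborel_pair)
  have [measurable]: "f \<in> borel_measurable borel" "g \<in> borel_measurable borel"
    using f g by (auto dest: borel_measurable_integrable)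
  show "(\<lambda>(x, y). f x * g y) \<in> borel_measurable borel"
    unfolding borel_prod[symmetric] by measurable
qed (use f g in \<open>auto simp: abs_mult\<close>)

lemma integrable_lborel_convolution:
  fixes f g :: "'a::euclidean_space \<Rightarrow> real"
  assumes f: "integrable lborel f" and g: "integrable lborel g"
  shows "integrable lborel (\<lambda>(x, y). f x * g (x - y))"
proof (rule integrable_lborel_pair)
  have [measurable]: "f \<in> borel_measurable borel" "g \<in> borel_measurable borel"
    using f g by (auto dest: borel_measurable_integrable)
  show "(\<lambda>(x, y). f x * g (x - y)) \<in> borel_measurable borel"
    unfolding borel_prod[symmetric] by measurable
  show "integrable lborel (\<lambda>y. case (x, y) of (x, y) \<Rightarrow> f x * g (x - y))" for x
    using g by (simp add: lborel_integral_shift_reflect)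
  have "(\<integral>y. \<bar>g (x - y)\<bar> \<partial>lborel) = (\<integral>y. \<bar>g y\<bar> \<partial>lborel)" for x
    by (rule lborel_integral_shift_reflect(2)[of "\<lambda>y. \<bar>g y\<bar>"]) measurable
  then show "integrable lborel (\<lambda>x. \<integral>y. \<bar>case (x, y) of (x, y) \<Rightarrow> f x * g (x - y)\<bar> \<partial>lborel)"
    using f by (simp add: abs_mult)
qed

section \<open>The truncated fractional Laplacian\<close>

text \<open>
  Halved, so that it is the mean of the increments \<open>v x - v (x + z)\<close> and \<open>v x - v (x - z)\<close>.
\<close>

definition second_diff :: "('a::real_vector \<Rightarrow> real) \<Rightarrow> 'a \<Rightarrow> 'a \<Rightarrow> real" where
  "second_diff v x z = (2 * v x - v (x + z) - v (x - z)) / 2"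

definition trunc_laplacian :: "real \<Rightarrow> real \<Rightarrow> (real ^ 'n \<Rightarrow> real) \<Rightarrow> real ^ 'n \<Rightarrow> real" where
  "trunc_laplacian s \<epsilon> v x = (LINT y:{y. \<epsilon> \<le> norm (x - y)}|lborel.
           (v x - v y) / norm (x - y) powr (real CARD('n) + 2 * s))"

lemma truncated_kernel_le_levy_weight:
  fixes z :: "real ^ 'n"
  assumes "0 < \<epsilon>" "\<epsilon> \<le> norm z"
  shows "1 / norm z powr (real CARD('n) + 2 * s) \<le> max 1 (1 / \<epsilon>\<^sup>2) * levy_weight s z"
proof -
  have "1 \<le> max 1 (1 / \<epsilon>\<^sup>2) * min 1 ((norm z)\<^sup>2)"
  proof (cases "norm z \<le> 1")
    case True
    have "\<epsilon>\<^sup>2 \<le> (norm z)\<^sup>2" using assms by (intro power_mono) auto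
    then have "1 \<le> 1 / \<epsilon>\<^sup>2 * (norm z)\<^sup>2" using assms by simp
    also have "\<dots> \<le> max 1 (1 / \<epsilon>\<^sup>2) * (norm z)\<^sup>2" by (intro mult_right_mono) auto
    also have "(norm z)\<^sup>2 = min 1 ((norm z)\<^sup>2)" using True by (simp add: power_le_one)
    finally show ?thesis .
  next
    case False
    then have "min 1 ((norm z)\<^sup>2) = 1" by (simp add: one_le_power)
    then show ?thesis by simp
  qed
  then have "1 / norm z powr (real CARD('n) + 2 * s)
      \<le> (max 1 (1 / \<epsilon>\<^sup>2) * min 1 ((norm z)\<^sup>2)) / norm z powr (real CARD('n) + 2 * s)"
    by (intro divide_right_mono) auto
  then show ?thesis by (simp add: levy_weight_def)
qed

lemma truncated_kernel_integrable:
  assumes s: "0 < s" "s < 1" and \<epsilon>: "0 < \<epsilon>"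
  shows "integrable lborel (\<lambda>z :: real ^ 'n. indicator {z. \<epsilon> \<le> norm z} z / norm z powr (real CARD('n) + 2 * s))"
proof (rule Bochner_Integration.integrable_bound)
  show "integrable lborel (\<lambda>z :: real ^ 'n. max 1 (1 / \<epsilon>\<^sup>2) * levy_weight s z)"
    by (intro integrable_mult_right integrable_levy_weight s)
  show "AE z in lborel. norm (indicator {z. \<epsilon> \<le> norm z} z / norm z powr (real CARD('n) + 2 * s))
      \<le> norm (max 1 (1 / \<epsilon>\<^sup>2) * levy_weight s (z :: real ^ 'n))"
  proof (rule AE_I2)
    fix z :: "real ^ 'n"
    show "norm (indicator {z. \<epsilon> \<le> norm z} z / norm z powr (real CARD('n) + 2 * s))
      \<le> norm (max 1 (1 / \<epsilon>\<^sup>2) * levy_weight s z)"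
      using truncated_kernel_le_levy_weight[OF \<epsilon>, of z s]
      by (cases "\<epsilon> \<le> norm z") (auto simp: levy_weight_nonneg abs_mult)
  qed
qed measurable

text \<open>
  The substitutions \<open>y = x + z\<close> and \<open>y = x - z\<close> both preserve Lebesgue measure and the kernel, so the
  truncated integral is the mean of the two resulting expressions. The first-order part of \<open>v\<close> at \<open>x\<close>
  cancels in this mean, which is what makes the limit of the truncations absolutely convergent.
\<close>

lemma trunc_laplacian_eq_second_diff:
  fixes v :: "real ^ 'n \<Rightarrow> real"
  assumes s: "0 < s" "s < 1" and \<epsilon>: "0 < \<epsilon>"
    and [measurable]: "v \<in> borel_measurable borel" and K: "\<And>y. \<bar>v y\<bar> \<le> K"
  shows "trunc_laplacian s \<epsilon> v x =
    (\<integral>z. indicator {z. \<epsilon> \<le> norm z} z * (second_diff v x z / norm z powr (real CARD('n) + 2 * s)) \<partial>lborel)"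
proof -
  define k where "k z = indicator {z. \<epsilon> \<le> norm z} z / norm z powr (real CARD('n) + 2 * s)" for z :: "real ^ 'n"
  have k: "integrable lborel k"
    unfolding k_def using truncated_kernel_integrable[OF s \<epsilon>] .
  then have [measurable]: "k \<in> borel_measurable borel"
    by (auto dest: borel_measurable_integrable)
  have k_minus: "k (- z) = k z" for z by (simp add: k_def indicator_def)
  define h where "h y = (v x - v y) * k (x - y)" for y
  have [measurable]: "h \<in> borel_measurable borel" unfolding h_def[abs_def] by measurable
  have T: "trunc_laplacian s \<epsilon> v x = (\<integral>y. h y \<partial>lborel)"
    unfolding trunc_laplacian_def set_lebesgue_integral_def h_def k_def
    by (intro Bochner_Integration.integral_cong) (auto simp: indicator_def)
  have bnd: "integrable lborel (\<lambda>z. (v x - v (a z)) * k z)" if [measurable]: "a \<in> borel_measurable borel" for a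
  proof (rule Bochner_Integration.integrable_bound)
    show "integrable lborel (\<lambda>z. 2 * K * k z)" using k by simp
    show "AE z in lborel. norm ((v x - v (a z)) * k z) \<le> norm (2 * K * k z)"
    proof (rule AE_I2)
      fix z
      have "\<bar>v x - v (a z)\<bar> \<le> \<bar>2 * K\<bar>" using K[of x] K[of "a z"] by linarith
      then show "norm ((v x - v (a z)) * k z) \<le> norm (2 * K * k z)"
        by (simp add: abs_mult mult_right_mono)
    qed
  qed measurable
  have "(\<integral>y. h y \<partial>lborel) = (\<integral>z. (v x - v (x + z)) * k z \<partial>lborel)"
    using lborel_integral_shift_reflect(1)[of h x] by (simp add: h_def k_minus)
  moreover have "(\<integral>y. h y \<partial>lborel) = (\<integral>z. (v x - v (x - z)) * k z \<partial>lborel)"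
    using lborel_integral_shift_reflect(2)[of h x] by (simp add: h_def)
  ultimately have "2 * (\<integral>y. h y \<partial>lborel)
      = (\<integral>z. (v x - v (x + z)) * k z \<partial>lborel) + (\<integral>z. (v x - v (x - z)) * k z \<partial>lborel)" by simp
  also have "\<dots> = (\<integral>z. (v x - v (x + z)) * k z + (v x - v (x - z)) * k z \<partial>lborel)"
    by (intro Bochner_Integration.integral_add[symmetric] bnd) measurable
  also have "\<dots> = (\<integral>z. 2 * (second_diff v x z * k z) \<partial>lborel)"
    by (intro Bochner_Integration.integral_cong) (auto simp: second_diff_def field_simps)
  also have "\<dots> = 2 * (\<integral>z. second_diff v x z * k z \<partial>lborel)" by simp
  finally show ?thesis unfolding T by (simp add: k_def mult.commute)
qed

lemma trunc_laplacian_bounded_tendsto: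
  fixes v :: "real ^ 'n \<Rightarrow> real"
  assumes s: "0 < s" "s < 1" 
    and [measurable]: "v \<in> borel_measurable borel" and K: "\<And>y. \<bar>v y\<bar> \<le> K"
    and B: "\<And>z. \<bar>second_diff v x z\<bar> \<le> B * min 1 ((norm z)\<^sup>2)"
  shows "0 < \<epsilon> \<Longrightarrow> \<bar>trunc_laplacian s \<epsilon> v x\<bar> \<le> B * (\<integral>z. levy_weight s (z :: real ^ 'n) \<partial>lborel)"
    and "((\<lambda>\<epsilon>. trunc_laplacian s \<epsilon> v x) \<longlongrightarrow> frac_laplacian 1 s v x) (at_right 0)"
proof -
  define q where "q z = second_diff v x z / norm z powr (real CARD('n) + 2 * s)" for z
  have [measurable]: "q \<in> borel_measurable borel"
    unfolding q_def[abs_def] second_diff_def by measurable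
  have lw: "integrable lborel (\<lambda>z::real ^ 'n. B * levy_weight s z)"
    by (intro integrable_mult_right integrable_levy_weight s)
  have q: "\<bar>q z\<bar> \<le> B * levy_weight s z" for z
    using divide_right_mono[OF B[of z], of "norm z powr (real CARD('n) + 2 * s)"]
    by (simp add: q_def levy_weight_def abs_divide)
  have iq: "\<bar>indicator {z. \<epsilon> \<le> norm z} z * q z\<bar> \<le> B * levy_weight s z" for z \<epsilon>
    using q[of z] abs_ge_zero[of "q z"] by (auto simp: indicator_def simp del: abs_ge_zero)
  have iqi: "integrable lborel (\<lambda>z. indicator {z. \<epsilon> \<le> norm z} z * q z)" for \<epsilon>
  proof (rule Bochner_Integration.integrable_bound[OF lw])
    show "AE z in lborel. norm (indicator {z. \<epsilon> \<le> norm z} z * q z) \<le> norm (B * levy_weight s z)"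
      using order_trans[OF iq abs_ge_self] by (intro AE_I2) simp
  qed measurable
  have eq: "trunc_laplacian s \<epsilon> v x = (\<integral>z. indicator {z. \<epsilon> \<le> norm z} z * q z \<partial>lborel)" if "0 < \<epsilon>" for \<epsilon>
    unfolding q_def by (rule trunc_laplacian_eq_second_diff[OF s that _ K]) measurable
  show "\<bar>trunc_laplacian s \<epsilon> v x\<bar> \<le> B * (\<integral>z. levy_weight s (z :: real ^ 'n) \<partial>lborel)" if "0 < \<epsilon>"
  proof -
    have "norm (\<integral>z. indicator {z. \<epsilon> \<le> norm z} z * q z \<partial>lborel) \<le> (\<integral>z. B * levy_weight s (z :: real ^ 'n) \<partial>lborel)"
      using iq lw by (intro Bochner_Integration.integral_norm_bound_integral iqi) auto
    then show ?thesis by (simp add: eq[OF that])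
  qed
  have lim: "((\<lambda>\<epsilon>. indicator {z. \<epsilon> \<le> norm z} z * q z) \<longlongrightarrow> q z) (at_right 0)" for z
  proof (cases "z = 0")
    case True
    then show ?thesis by (simp add: q_def)
  next
    case False
    have "\<forall>\<^sub>F \<epsilon> in at_right 0. q z = indicator {z. \<epsilon> \<le> norm z} z * q z"
      using eventually_at_right_less[of 0] eventually_at_rightI[of 0 "norm z" "\<lambda>\<epsilon>. \<epsilon> \<le> norm z"] False
      by (auto elim!: eventually_mono simp: indicator_def)
    then show ?thesis by (rule Lim_transform_eventually[OF tendsto_const])
  qed
  have "((\<lambda>\<epsilon>. \<integral>z. indicator {z. \<epsilon> \<le> norm z} z * q z \<partial>lborel) \<longlongrightarrow> (\<integral>z. q z \<partial>lborel)) (at_right 0)"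
    by (rule dominated_at_right_zero(2)[of _ lborel, OF _ lim iq lw]) auto
  then have L: "((\<lambda>\<epsilon>. trunc_laplacian s \<epsilon> v x) \<longlongrightarrow> (\<integral>z. q z \<partial>lborel)) (at_right 0)"
    by (rule Lim_transform_eventually)
       (auto intro!: eventually_mono[OF eventually_at_right_less] simp: eq)
  moreover have "frac_laplacian 1 s v x = (\<integral>z. q z \<partial>lborel)"
    using tendsto_Lim[OF _ L] unfolding frac_laplacian_def trunc_laplacian_def by simp
  ultimately show "((\<lambda>\<epsilon>. trunc_laplacian s \<epsilon> v x) \<longlongrightarrow> frac_laplacian 1 s v x) (at_right 0)"
    by simp
qed

lemma frac_laplacian_scale: "frac_laplacian c s v x = c * frac_laplacian 1 s v x"
  by (simp add: frac_laplacian_def)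

section \<open>Geometry of the field\<close>

locale bounded_field =
  fixes I :: "real set" and u :: "real \<Rightarrow> real ^ 'n \<Rightarrow> real" and K :: real
  assumes interval: "is_interval I"
    and field: "C2_field I u"
    and bound: "t \<in> I \<Longrightarrow> \<bar>u t x\<bar> \<le> K"
begin

lemma increasing: "t \<in> I \<Longrightarrow> t' \<in> I \<Longrightarrow> t < t' \<Longrightarrow> u t x < u t' x"
  using field unfolding C2_field_def strict_mono_on_def by blast

lemma less_iff: "t \<in> I \<Longrightarrow> t' \<in> I \<Longrightarrow> u t x < u t' x \<longleftrightarrow> t < t'"
  using increasing[of t t' x] increasing[of t' t x] by (cases t t' rule: linorder_cases) auto

lemma le_iff: "t \<in> I \<Longrightarrow> t' \<in> I \<Longrightarrow> u t x \<le> u t' x \<longleftrightarrow> t \<le> t'"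
  using less_iff[of t' t x] by (simp add: linorder_not_less[symmetric])

lemma continuous_field: "continuous_on (UNIV \<times> I) (\<lambda>(x, t). u t x)"
proof -
  obtain f' where "\<And>z. z \<in> UNIV \<times> I \<Longrightarrow>
      ((\<lambda>(x, t). u t x) has_derivative blinfun_apply (f' z)) (at z within UNIV \<times> I)"
    using field unfolding C2_field_def C2_on_def by blast
  then show ?thesis by (rule has_derivative_continuous_on)
qed

lemma continuous_field_compose:
  assumes "continuous_on S f" "continuous_on S g" "\<And>p. p \<in> S \<Longrightarrow> g p \<in> I"
  shows "continuous_on S (\<lambda>p. u (g p) (f p))"
  using continuous_on_compose2[OF continuous_field, of S "\<lambda>p. (f p, g p)"] assms
  by (auto intro!: continuous_intros)

lemma continuous_leaf: "t \<in> I \<Longrightarrow> continuous_on S (u t)"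
  by (rule continuous_field_compose[of _ "\<lambda>x. x" "\<lambda>_. t"]) (auto intro!: continuous_intros)

lemma measurable_leaf: "t \<in> I \<Longrightarrow> u t \<in> borel_measurable borel"
  by (intro borel_measurable_continuous_onI continuous_leaf)

lemma leaf_param_eq: "t \<in> I \<Longrightarrow> leaf_param I u x (u t x) = t"
  unfolding leaf_param_def using less_iff by (intro the_equality) (auto, metis linorder_neqE_linordered_idom less_irrefl)

lemma leaf_param:
  assumes "(x, l) \<in> field_region I u"
  shows "leaf_param I u x l \<in> I" "u (leaf_param I u x l) x = l"
  using assms leaf_param_eq by (auto simp: field_region_def)

lemma graph_leaf: "t \<in> I \<Longrightarrow> (x, u t x) \<in> field_region I u"
  by (auto simp: field_region_def)

text \<open>
  The fibre of the field region over \<open>x\<close> is the continuous image of an interval.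
\<close>

lemma segment_in_field_region:
  assumes "(x, a) \<in> field_region I u" "(x, b) \<in> field_region I u" "l \<in> closed_segment a b"
  shows "(x, l) \<in> field_region I u"
proof -
  have "connected ((\<lambda>t. u t x) ` I)"
    using interval by (intro connected_continuous_image continuous_field_compose[of I "\<lambda>_. x" "\<lambda>t. t"])
       (auto simp: is_interval_connected_1)
  then have "is_interval ((\<lambda>t. u t x) ` I)" by (simp add: is_interval_connected_1)
  then have "convex ((\<lambda>t. u t x) ` I)" by (simp add: is_interval_convex_1)
  then have "closed_segment a b \<subseteq> (\<lambda>t. u t x) ` I"
    using assms(1,2) by (intro closed_segment_subset) (auto simp: field_region_def)
  then show ?thesis using assms(3) by (auto simp: field_region_def)
qed

text \<open>
  The derivative \<open>\<partial>\<^sub>t u\<close> may vanish, so the inverse function theorem does not apply. Continuity comes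
  from the order instead: if \<open>t'\<close> lies strictly below the parameter of \<open>(x0, l0)\<close>, the leaf \<open>u\<^bsup>t'\<^esup>\<close>
  passes strictly below \<open>(x0, l0)\<close>, hence below all nearby points, whose parameters then exceed \<open>t'\<close>; similarly from above. If no such \<open>t'\<close> exists, the
  parameter is an end point of \<open>I\<close> and the bound on that side is automatic.
\<close>

lemma continuous_leaf_param:
  "continuous_on (field_region I u) (\<lambda>(x, l). leaf_param I u x l)"
  unfolding continuous_on_def
proof
  fix p0 assume p0: "p0 \<in> field_region I u"
  obtain x0 l0 where x0: "p0 = (x0, l0)" by (cases p0)
  have p: "(x0, l0) \<in> field_region I u" using p0 x0 by simp
  let ?F = "at (x0, l0) within field_region I u"
  define t where "t = leaf_param I u x0 l0"
  have t: "t \<in> I" "u t x0 = l0" using leaf_param[OF p] by (simp_all add: t_def)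
  have between: "b \<in> I" if "r \<in> I" "r' \<in> I" "r \<le> b" "b \<le> r'" for r r' b
    using interval that unfolding is_interval_1 by blast
  have inG: "\<forall>\<^sub>F q in ?F. q \<in> field_region I u" by (simp add: eventually_at_filter)
  have u_lim: "((\<lambda>(x, l). u t' x - l) \<longlongrightarrow> u t' x0 - l0) ?F" if "t' \<in> I" for t'
  proof -
    have "continuous_on (field_region I u) (\<lambda>(x, l). u t' x - l)"
      unfolding case_prod_beta
      by (intro continuous_intros continuous_field_compose[of _ fst "\<lambda>_. t'"] that)
    then show ?thesis using p by (auto simp: continuous_on_def)
  qed
  have "((\<lambda>(x, l). leaf_param I u x l) \<longlongrightarrow> t) ?F"
  proof (rule order_tendstoI)
    fix a assume a: "a < t"
    show "\<forall>\<^sub>F q in ?F. a < (case q of (x, l) \<Rightarrow> leaf_param I u x l)"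
    proof (cases "\<exists>t'\<in>I. a \<le> t' \<and> t' < t")
      case True
      then obtain t' where t': "t' \<in> I" "a \<le> t'" "t' < t" by blast
      have "u t' x0 - l0 < 0" using t t' less_iff by fastforce
      from order_tendstoD(2)[OF u_lim[OF t'(1)] this] inG show ?thesis
      proof eventually_elim
        case (elim q)
        obtain x l where q: "q = (x, l)" by (cases q)
        with elim t'(1) leaf_param[of x l] less_iff[of t' "leaf_param I u x l" x]
        show ?case using t'(2) by simp
      qed
    next
      case False
      then have "t \<le> r" if "r \<in> I" for r
        using between[OF that t(1), of a] a that by force
      with a leaf_param(1) show ?thesis
        by (intro eventually_mono[OF inG]) (fastforce split: prod.splits)
    qed
  next
    fix a assume a: "t < a"
    show "\<forall>\<^sub>F q in ?F. (case q of (x, l) \<Rightarrow> leaf_param I u x l) < a"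
    proof (cases "\<exists>t'\<in>I. t' \<le> a \<and> t < t'")
      case True
      then obtain t' where t': "t' \<in> I" "t' \<le> a" "t < t'" by blast
      have "0 < u t' x0 - l0" using t t' less_iff by fastforce
      from order_tendstoD(1)[OF u_lim[OF t'(1)] this] inG show ?thesis
      proof eventually_elim
        case (elim q)
        obtain x l where q: "q = (x, l)" by (cases q)
        with elim t'(1) leaf_param[of x l] less_iff[of "leaf_param I u x l" t' x]
        show ?case using t'(2) by simp
      qed
    next
      case False
      then have "r \<le> t" if "r \<in> I" for r
        using between[OF t(1) that, of a] a that by force
      with a leaf_param(1) show ?thesis
        by (intro eventually_mono[OF inG]) (fastforce split: prod.splits)
    qed
  qed
  then show "((\<lambda>(x, l). leaf_param I u x l) \<longlongrightarrow> (case p0 of (x, l) \<Rightarrow> leaf_param I u x l)) (at p0 within field_region I u)"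
    by (simp add: t_def x0)
qed

lemma continuous_leaf_param_compose:
  assumes "continuous_on S f" "continuous_on S g" "\<And>p. p \<in> S \<Longrightarrow> (f p, g p) \<in> field_region I u"
  shows "continuous_on S (\<lambda>p. leaf_param I u (f p) (g p))"
  using continuous_on_compose2[OF continuous_leaf_param, of S "\<lambda>p. (f p, g p)"] assms
  by (auto intro!: continuous_intros)

text \<open>
  The first and second derivatives in \<open>x\<close> are restrictions of the derivatives of the field on
  \<open>\<real>\<^sup>n \<times> I\<close>, which are continuous and therefore bounded on the compact set of points within distance
  \<open>1\<close> of the ball of radius \<open>R\<close> and parameters in \<open>J\<close>. The second-difference bound follows from the
  first-order Taylor formula at \<open>x\<close> applied to \<open>z\<close> and \<open>-z\<close>.
\<close>

lemma local_derivative_bounds: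
  assumes J: "compact J" "J \<subseteq> I"
  obtains M where "0 \<le> M"
    "\<And>t x z. t \<in> J \<Longrightarrow> norm x \<le> R \<Longrightarrow> norm z \<le> 1 \<Longrightarrow> \<bar>second_diff (u t) x z\<bar> \<le> M * (norm z)\<^sup>2"
    "\<And>t x z. t \<in> J \<Longrightarrow> norm x \<le> R \<Longrightarrow> norm z \<le> 1 \<Longrightarrow> \<bar>u t x - u t (x + z)\<bar> \<le> M * norm z"
proof -
  obtain f' :: "(real ^ 'n) \<times> real \<Rightarrow> ((real ^ 'n) \<times> real) \<Rightarrow>\<^sub>L real"
    and f'' :: "(real ^ 'n) \<times> real \<Rightarrow> ((real ^ 'n) \<times> real) \<Rightarrow>\<^sub>L ((real ^ 'n) \<times> real) \<Rightarrow>\<^sub>L real"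
    where f': "\<And>z. z \<in> UNIV \<times> I \<Longrightarrow> ((\<lambda>(x, t). u t x) has_derivative blinfun_apply (f' z)) (at z within UNIV \<times> I)"
      and f'': "\<And>z. z \<in> UNIV \<times> I \<Longrightarrow> (f' has_derivative blinfun_apply (f'' z)) (at z within UNIV \<times> I)"
      and cont: "continuous_on (UNIV \<times> I) f''"
    using field unfolding C2_field_def C2_on_def by blast
  define S where "S = cball (0 :: real ^ 'n) (R + 1) \<times> J"
  have S: "compact S" "S \<subseteq> UNIV \<times> I" using J by (auto simp: S_def compact_Times)
  have cont': "continuous_on (UNIV \<times> I) f'" using f'' by (rule has_derivative_continuous_on)
  obtain M1 where M1: "\<And>z. z \<in> S \<Longrightarrow> norm (f' z) \<le> M1"
    using compact_imp_bounded[OF compact_continuous_image[OF continuous_on_subset[OF cont' S(2)] S(1)]]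
    by (auto simp: bounded_iff)
  obtain M2 where M2: "\<And>z. z \<in> S \<Longrightarrow> norm (f'' z) \<le> M2"
    using compact_imp_bounded[OF compact_continuous_image[OF continuous_on_subset[OF cont S(2)] S(1)]]
    by (auto simp: bounded_iff)
  define M where "M = max 0 (max M1 M2)"
  let ?C = "cball (0 :: real ^ 'n) (R + 1)"
  \<comment> \<open>Derivatives in the space variable alone are obtained by composing with a horizontal slice.\<close>
  have pair: "((\<lambda>x. (x, t)) has_derivative (\<lambda>h. (h, 0))) (at x within X)" for x :: "real ^ 'n" and t :: real and X
    by (auto intro!: derivative_eq_intros)
  have du: "(u t has_derivative (\<lambda>h. f' (x, t) (h, 0))) (at x within ?C)" if "t \<in> J" for t x
    using has_derivative_in_compose[OF pair[of t x ?C] has_derivative_subset[OF f']] that J(2) by auto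
  have du': "((\<lambda>x. f' (x, t)) has_derivative (\<lambda>h. f'' (x, t) (h, 0))) (at x within ?C)" if "t \<in> J" for t x
    using has_derivative_in_compose[OF pair[of t x ?C] has_derivative_subset[OF f'']] that J(2) by auto
  have on': "onorm (\<lambda>h. f' (x, t) (h, 0)) \<le> M" if "t \<in> J" "x \<in> ?C" for t x
  proof (rule onorm_le)
    fix h :: "real ^ 'n"
    have "norm (f' (x, t) (h, 0)) \<le> norm (f' (x, t)) * norm (h, 0::real)" by (rule norm_blinfun)
    also have "\<dots> \<le> M * norm h"
      using M1[of "(x, t)"] that by (auto simp: S_def M_def norm_Pair intro!: mult_right_mono)
    finally show "norm (f' (x, t) (h, 0)) \<le> M * norm h" .
  qed
  have on'': "onorm (\<lambda>h. f'' (x, t) (h, 0)) \<le> M" if "t \<in> J" "x \<in> ?C" for t x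
  proof (rule onorm_le)
    fix h :: "real ^ 'n"
    have "norm (f'' (x, t) (h, 0)) \<le> norm (f'' (x, t)) * norm (h, 0::real)" by (rule norm_blinfun)
    also have "\<dots> \<le> M * norm h"
      using M2[of "(x, t)"] that by (auto simp: S_def M_def norm_Pair intro!: mult_right_mono)
    finally show "norm (f'' (x, t) (h, 0)) \<le> M * norm h" .
  qed
  have in_C: "x \<in> ?C" "x + z \<in> ?C" if "norm x \<le> R" "norm z \<le> 1" for x z :: "real ^ 'n"
    using that norm_triangle_ineq[of x z] by auto
  have taylor: "\<bar>u t (x + z) - u t x - f' (x, t) (z, 0)\<bar> \<le> M * (norm z)\<^sup>2"
    if t: "t \<in> J" and x: "norm x \<le> R" and z: "norm z \<le> 1" for t x z
  proof -
    let ?G = "closed_segment x (x + z)"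
    have G: "?G \<subseteq> ?C" using in_C[OF x z] by (intro closed_segment_subset) auto
    have "norm (u t (x + z) - u t x - f' (x, t) (x + z - x, 0)) \<le> norm (x + z - x) * (M * norm z)"
    proof (rule differentiable_bound_linearization[where S = ?G and f' = "\<lambda>y h. f' (y, t) (h, 0)"])
      show "x + r *\<^sub>R (x + z - x) \<in> ?G" if "r \<in> {0..1}" for r
        using that by (auto simp: in_segment intro!: exI[of _ r] simp: algebra_simps)
      show "(u t has_derivative (\<lambda>h. f' (y, t) (h, 0))) (at y within ?G)" for y
        using has_derivative_subset[OF du[OF t] G] .
      show "onorm ((\<lambda>h. f' (y, t) (h, 0)) - (\<lambda>h. f' (x, t) (h, 0))) \<le> M * norm z" if y: "y \<in> ?G" for y
      proof (rule onorm_le)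
        fix h :: "real ^ 'n"
        have "norm (f' (y, t) - f' (x, t)) \<le> M * norm (y - x)"
          using y G in_C[OF x z] by (intro differentiable_bound[OF _ du'[OF t] on''[OF t]]) auto
        also have "\<dots> \<le> M * norm z"
          using segment_bound1[OF y] by (auto simp: M_def intro!: mult_left_mono)
        finally have "norm (f' (y, t) - f' (x, t)) * norm (h, 0::real) \<le> M * norm z * norm h"
          by (auto simp: norm_Pair intro!: mult_right_mono)
        then show "norm (((\<lambda>h. f' (y, t) (h, 0)) - (\<lambda>h. f' (x, t) (h, 0))) h) \<le> M * norm z * norm h"
          using norm_blinfun[of "f' (y, t) - f' (x, t)" "(h, 0)"] by (simp add: minus_blinfun.rep_eq)
      qed
    qed auto
    then show ?thesis by (simp add: power2_eq_square mult.assoc mult.left_commute)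
  qed
  show ?thesis
  proof (rule that[of M])
    show "0 \<le> M" by (simp add: M_def)
    fix t and x z :: "real ^ 'n" assume t: "t \<in> J" and x: "norm x \<le> R" and z: "norm z \<le> 1"
    have "f' (x, t) (- z, 0) = - f' (x, t) (z, 0)"
      using blinfun.minus_right[of "f' (x, t)" "(z, 0)"] by simp
    then show "\<bar>second_diff (u t) x z\<bar> \<le> M * (norm z)\<^sup>2"
      using taylor[OF t x z] taylor[OF t x, of "- z"] z unfolding second_diff_def by simp
    have "norm (u t x - u t (x + z)) \<le> M * norm (x - (x + z))"
      using in_C[OF x z] by (intro differentiable_bound[OF _ du[OF t] on'[OF t]]) auto
    then show "\<bar>u t x - u t (x + z)\<bar> \<le> M * norm z" by simp
  qed
qed

lemma second_diff_bound:
  assumes J: "compact J" "J \<subseteq> I" and "bounded X"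
  obtains M where "0 \<le> M"
    "\<And>t x z. t \<in> J \<Longrightarrow> x \<in> X \<Longrightarrow> \<bar>second_diff (u t) x z\<bar> \<le> M * min 1 ((norm z)\<^sup>2)"
proof -
  obtain R where R: "\<And>x. x \<in> X \<Longrightarrow> norm x \<le> R" using \<open>bounded X\<close> by (auto simp: bounded_iff)
  obtain M where M: "0 \<le> M"
    "\<And>t x z. t \<in> J \<Longrightarrow> norm x \<le> R \<Longrightarrow> norm z \<le> 1 \<Longrightarrow> \<bar>second_diff (u t) x z\<bar> \<le> M * (norm z)\<^sup>2"
    using local_derivative_bounds[OF J, of R] by metis
  show ?thesis
  proof (rule that[of "max M (2 * K)"])
    fix t x and z :: "real ^ 'n" assume t: "t \<in> J" and x: "x \<in> X"
    show "\<bar>second_diff (u t) x z\<bar> \<le> max M (2 * K) * min 1 ((norm z)\<^sup>2)"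
    proof (cases "norm z \<le> 1")
      case True
      have "\<bar>second_diff (u t) x z\<bar> \<le> M * (norm z)\<^sup>2" using M(2)[OF t R[OF x] True] .
      also have "\<dots> \<le> max M (2 * K) * (norm z)\<^sup>2" by (intro mult_right_mono) auto
      finally show ?thesis using True by (simp add: power_le_one)
    next
      case False
      then have "min 1 ((norm z)\<^sup>2) = 1" by (simp add: one_le_power)
      then show ?thesis
        using bound[of t x] bound[of t "x + z"] bound[of t "x - z"] t J(2)
        by (auto simp: second_diff_def)
    qed
  qed (use M(1) in simp)
qed

lemma leaf_difference_bound:
  assumes t: "t \<in> I" and "bounded X"
  obtains M where "0 \<le> M"
    "\<And>x y. x \<in> X \<Longrightarrow> \<bar>u t x - u t y\<bar>\<^sup>2 \<le> M * min 1 ((norm (x - y))\<^sup>2)"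
proof -
  obtain R where R: "\<And>x. x \<in> X \<Longrightarrow> norm x \<le> R" using \<open>bounded X\<close> by (auto simp: bounded_iff)
  have J: "compact {t}" "{t} \<subseteq> I" using t by auto
  obtain M where M: "0 \<le> M"
    "\<And>x z. norm x \<le> R \<Longrightarrow> norm z \<le> 1 \<Longrightarrow> \<bar>u t x - u t (x + z)\<bar> \<le> M * norm z"
    using local_derivative_bounds[OF J, of R] by (metis singletonI)
  show ?thesis
  proof (rule that[of "(max M (2 * K))\<^sup>2"])
    fix x y assume x: "x \<in> X"
    have K: "0 \<le> K" using bound[OF t, of x] by linarith
    have "\<bar>u t x - u t y\<bar> \<le> max M (2 * K) * min 1 (norm (x - y))"
    proof (cases "norm (x - y) \<le> 1")
      case True
      have "\<bar>u t x - u t y\<bar> \<le> M * norm (x - y)"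
        using M(2)[OF R[OF x], of "y - x"] True by (simp add: norm_minus_commute)
      also have "\<dots> \<le> max M (2 * K) * norm (x - y)" by (intro mult_right_mono) auto
      finally show ?thesis using True by simp
    next
      case False
      then show ?thesis using bound[OF t, of x] bound[OF t, of y] by simp
    qed
    from power_mono[OF this, of 2]
    have "\<bar>u t x - u t y\<bar>\<^sup>2 \<le> (max M (2 * K))\<^sup>2 * (min 1 (norm (x - y)))\<^sup>2"
      by (simp add: power_mult_distrib)
    also have "(min 1 (norm (x - y)))\<^sup>2 = min 1 ((norm (x - y))\<^sup>2)"
      using one_le_power[of "norm (x - y)" 2] by (cases "norm (x - y) \<le> 1") (auto simp: power_le_one)
    finally show "\<bar>u t x - u t y\<bar>\<^sup>2 \<le> (max M (2 * K))\<^sup>2 * min 1 ((norm (x - y))\<^sup>2)" .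
  qed simp
qed

end

section \<open>A Young inequality along the field\<close>

lemma interval_integral_affine:
  "(LBINT l=ereal a..ereal b. l - k) = ((b - k)\<^sup>2 - (a - k)\<^sup>2) / (2 :: real)"
proof -
  have "(LBINT l=ereal a..ereal b. l - k) = (b - k)\<^sup>2 / 2 - (a - k)\<^sup>2 / 2"
    by (rule interval_integral_FTC_finite)
       (auto intro!: continuous_intros derivative_eq_intros simp: has_real_derivative_iff_has_vector_derivative[symmetric])
  then show ?thesis by (simp add: diff_divide_distrib)
qed

lemma interval_integral_mono:
  fixes f g :: "real \<Rightarrow> real"
  assumes "a \<le> b" "interval_lebesgue_integrable lborel (ereal a) (ereal b) f"
    "interval_lebesgue_integrable lborel (ereal a) (ereal b) g"
    "\<And>l. a < l \<Longrightarrow> l < b \<Longrightarrow> f l \<le> g l"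
  shows "(LBINT l=ereal a..ereal b. f l) \<le> (LBINT l=ereal a..ereal b. g l)"
  using assms unfolding interval_lebesgue_integral_def interval_lebesgue_integrable_def
  by (auto intro!: set_integral_mono)

context bounded_field
begin

text \<open>
  The height at \<open>x\<close> minus the height at \<open>y\<close> of the leaf through \<open>(x, l)\<close>: the numerator of
  \<^const>\<open>leaf_quotient\<close>.
\<close>

definition gap :: "real ^ 'n \<Rightarrow> real ^ 'n \<Rightarrow> real \<Rightarrow> real" where
  "gap x y l = l - u (leaf_param I u x l) y"

lemma field_region_between:
  assumes "(x, a) \<in> field_region I u" "(x, b) \<in> field_region I u" "a \<le> l" "l \<le> b"
  shows "(x, l) \<in> field_region I u"
  using segment_in_field_region[OF assms(1,2), of l] assms(3,4) by (simp add: closed_segment_eq_real_ivl)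

lemma continuous_gap:
  assumes "\<And>l. l \<in> S \<Longrightarrow> (x, l) \<in> field_region I u"
  shows "continuous_on S (gap x y)"
  unfolding gap_def[abs_def]
  by (intro continuous_intros continuous_field_compose continuous_leaf_param_compose)
     (use assms leaf_param in auto)

lemma interval_integrable_gap:
  assumes "(x, a) \<in> field_region I u" "(x, b) \<in> field_region I u"
  shows "interval_lebesgue_integrable lborel (ereal a) (ereal b) (gap x y)"
proof -
  have *: "interval_lebesgue_integrable lborel (ereal a) (ereal b) (gap x y)"
    if "a \<le> b" "(x, a) \<in> field_region I u" "(x, b) \<in> field_region I u" for a b
    using that by (intro interval_integrable_continuous_on continuous_gap)
      (auto intro: field_region_between)
  show ?thesis
    using *[of a b] *[of b a] assms interval_integrable_endpoints_reverse
    by (cases "a \<le> b") auto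
qed

definition gap_integral :: "real \<Rightarrow> real \<Rightarrow> real ^ 'n \<Rightarrow> real ^ 'n \<Rightarrow> real" where
  "gap_integral a b x y = (LBINT l=ereal (u a x)..ereal (u b x). gap x y l)"

lemma gap_integral_add:
  assumes "a \<in> I" "b \<in> I" "d \<in> I"
  shows "gap_integral a b x y + gap_integral b d x y = gap_integral a d x y"
  unfolding gap_integral_def
proof (rule interval_integral_sum)
  let ?lo = "min (u a x) (min (u b x) (u d x))" and ?hi = "max (u a x) (max (u b x) (u d x))"
  have "(x, ?lo) \<in> field_region I u" "(x, ?hi) \<in> field_region I u"
    using assms by (auto simp: min_def max_def graph_leaf)
  from interval_integrable_gap[OF this, of y]
  show "interval_lebesgue_integrable lborel (min (ereal (u a x)) (min (ereal (u b x)) (ereal (u d x))))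
     (max (ereal (u a x)) (max (ereal (u b x)) (ereal (u d x)))) (gap x y)"
    by (simp add: ereal_min ereal_max)
qed

text \<open>
  The substitution \<open>l = u t x\<close> turns the two integrals into
  \<open>\<integral> \<partial>\<^sub>t u\<^sup>t(x) (u\<^sup>t(x) - u\<^sup>t(y)) dt\<close> and \<open>\<integral> \<partial>\<^sub>t u\<^sup>t(y) (u\<^sup>t(y) - u\<^sup>t(x)) dt\<close>, and their sum has the exact
  integrand \<open>d/dt (u\<^sup>t(x) - u\<^sup>t(y))\<^sup>2 / 2\<close>.
\<close>

lemma gap_integral_diagonal_ordered:
  assumes a: "a \<in> I" and b: "b \<in> I" and "a \<le> b"
  shows "gap_integral a b x y + gap_integral a b y x
    = ((u b x - u b y)\<^sup>2 - (u a x - u a y)\<^sup>2) / 2"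
proof -
  have sub: "{a..b} \<subseteq> I"
  proof
    fix t assume "t \<in> {a..b}"
    then show "t \<in> I" using interval a b unfolding is_interval_1 by (meson atLeastAtMost_iff)
  qed
  obtain d where d: "\<And>x t. t \<in> I \<Longrightarrow> ((\<lambda>t. u t x) has_real_derivative d x t) (at t within I)"
    and dc: "\<And>x. continuous_on I (d x)"
    using field unfolding C2_field_def C1_on_def by metis
  have d': "((\<lambda>t. u t x) has_real_derivative d x t) (at t within {a..b})" if "t \<in> {a..b}" for x t
    using DERIV_subset[OF d sub] that sub by blast
  have dc': "continuous_on {a..b} (d x)" for x using continuous_on_subset[OF dc sub] .
  have cu: "continuous_on {a..b} (\<lambda>t. u t x)" for x
    using sub by (intro continuous_field_compose continuous_intros) auto
  have subst: "gap_integral a b x y = (LBINT t=a..b. d x t * (u t x - u t y))" for x y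
  proof -
    have "(LBINT t=ereal a..ereal b. d x t *\<^sub>R gap x y (u t x)) = gap_integral a b x y"
      unfolding gap_integral_def
    proof (rule interval_integral_substitution_finite[OF \<open>a \<le> b\<close> _ _ dc'])
      show "((\<lambda>t. u t x) has_real_derivative d x t) (at t within {a..b})" if "a \<le> t" "t \<le> b" for t
        using d' that by simp
      show "continuous_on ((\<lambda>t. u t x) ` {a..b}) (gap x y)"
        using sub by (intro continuous_gap) (auto intro: graph_leaf)
    qed
    moreover have "(LBINT t=ereal a..ereal b. d x t *\<^sub>R gap x y (u t x))
        = (LBINT t=ereal a..ereal b. d x t * (u t x - u t y))"
      using \<open>a \<le> b\<close> sub
      by (intro interval_integral_cong) (auto simp: einterval_eq min_def gap_def leaf_param_eq subset_eq)
    ultimately show ?thesis by simp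
  qed
  have int: "interval_lebesgue_integrable lborel (ereal a) (ereal b) (\<lambda>t. d x t * (u t x - u t y))" for x y
    by (intro interval_integrable_continuous_on continuous_intros dc' cu \<open>a \<le> b\<close>)
  have "gap_integral a b x y + gap_integral a b y x
      = (LBINT t=a..b. d x t * (u t x - u t y) + d y t * (u t y - u t x))"
    unfolding subst using int by (intro interval_lebesgue_integral_add(2)[symmetric])
  also have "\<dots> = (u b x - u b y)\<^sup>2 / 2 - (u a x - u a y)\<^sup>2 / 2"
  proof (rule interval_integral_FTC_finite)
    have mm: "{min a b..max a b} = {a..b}" using \<open>a \<le> b\<close> by simp
    show "continuous_on {min a b..max a b} (\<lambda>t. d x t * (u t x - u t y) + d y t * (u t y - u t x))"
      unfolding mm by (intro continuous_intros dc' cu)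
    fix t assume "min a b \<le> t" "t \<le> max a b"
    then have t: "t \<in> {a..b}" using \<open>a \<le> b\<close> by simp
    show "((\<lambda>t. (u t x - u t y)\<^sup>2 / 2) has_vector_derivative
        d x t * (u t x - u t y) + d y t * (u t y - u t x)) (at t within {min a b..max a b})"
      unfolding mm has_real_derivative_iff_has_vector_derivative[symmetric]
      by (auto intro!: derivative_eq_intros d'[OF t] simp: field_simps)
  qed
  finally show ?thesis by (simp add: diff_divide_distrib)
qed

lemma gap_integral_diagonal:
  assumes a: "a \<in> I" and b: "b \<in> I"
  shows "gap_integral a b x y + gap_integral a b y x
    = ((u b x - u b y)\<^sup>2 - (u a x - u a y)\<^sup>2) / 2"
proof (cases "a \<le> b")
  case True
  then show ?thesis using gap_integral_diagonal_ordered assms by blast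
next
  case False
  have "gap_integral a b x y = - gap_integral b a x y" for x y
    unfolding gap_integral_def by (rule interval_integral_endpoints_reverse)
  then show ?thesis using gap_integral_diagonal_ordered[OF b a, of x y] False
    by (simp add: field_simps)
qed

text \<open>
  Above \<open>u a y\<close> the leaf through \<open>(y, l)\<close> lies above the leaf \<open>u a\<close>, so that replacing its height at \<open>x\<close> by
  \<open>u a x\<close> increases the integrand; below \<open>u a y\<close> the integrand decreases, but the integral is then
  oriented downwards.
\<close>

lemma gap_integral_le:
  assumes a: "a \<in> I" and b: "b \<in> I"
  shows "gap_integral a b y x \<le> ((u b y - u a x)\<^sup>2 - (u a y - u a x)\<^sup>2) / 2"
proof -
  have *: "interval_lebesgue_integrable lborel (ereal p) (ereal q) (\<lambda>l. l - u a x)" if "p \<le> q" for p q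
    using that by (intro interval_integrable_continuous_on continuous_intros)
  have G: "(y, u a y) \<in> field_region I u" "(y, u b y) \<in> field_region I u"
    using a b by (auto intro: graph_leaf)
  show ?thesis
  proof (cases "a \<le> b")
    case True
    then have le: "u a y \<le> u b y" using le_iff a b by simp
    have "gap_integral a b y x \<le> (LBINT l=ereal (u a y)..ereal (u b y). l - u a x)"
      unfolding gap_integral_def
    proof (rule interval_integral_mono[OF le interval_integrable_gap[OF G] *[OF le]])
      fix l assume l: "u a y < l" "l < u b y"
      then have m: "(y, l) \<in> field_region I u" using field_region_between[OF G, of l] by simp
      have "a < leaf_param I u y l" using less_iff[OF a leaf_param(1)[OF m]] leaf_param(2)[OF m] l by metis
      then show "gap y x l \<le> l - u a x"
        using increasing[OF a leaf_param(1)[OF m], of x] by (simp add: gap_def)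
    qed
    then show ?thesis by (simp add: interval_integral_affine)
  next
    case False
    then have le: "u b y \<le> u a y" using le_iff a b by simp
    have "(LBINT l=ereal (u b y)..ereal (u a y). l - u a x) \<le> gap_integral b a y x"
      unfolding gap_integral_def
    proof (rule interval_integral_mono[OF le *[OF le] interval_integrable_gap[OF G(2,1)]])
      fix l assume l: "u b y < l" "l < u a y"
      then have m: "(y, l) \<in> field_region I u" using field_region_between[OF G(2,1), of l] by simp
      have "leaf_param I u y l < a" using less_iff[OF leaf_param(1)[OF m] a] leaf_param(2)[OF m] l by metis
      then show "l - u a x \<le> gap y x l"
        using increasing[OF leaf_param(1)[OF m] a, of x] by (simp add: gap_def)
    qed
    moreover have "gap_integral a b y x = - gap_integral b a y x"
      unfolding gap_integral_def by (rule interval_integral_endpoints_reverse)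
    ultimately show ?thesis by (simp add: interval_integral_affine field_simps)
  qed
qed

text \<open>
  Both points first move from \<open>t0\<close> to \<open>a\<close>, which is the exact diagonal identity; then \<open>y\<close> alone moves from
  \<open>a\<close> to \<open>b\<close>, at the cost of the inequality \<open>gap_integral_le\<close>.
\<close>

lemma gap_integral_young:
  assumes "t0 \<in> I" "a \<in> I" "b \<in> I"
  shows "gap_integral t0 a x y + gap_integral t0 b y x
    \<le> ((u a x - u b y)\<^sup>2 - (u t0 x - u t0 y)\<^sup>2) / 2"
proof -
  have "gap_integral t0 b y x = gap_integral t0 a y x + gap_integral a b y x"
    using gap_integral_add assms by simp
  with gap_integral_diagonal[of t0 a x y] gap_integral_le[of a b y x] assms
  show ?thesis by (simp add: power2_commute[of "u b y"] power2_commute[of "u a y"] field_simps)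
qed

end

section \<open>The principal value as an integral of fractional Laplacians\<close>

locale field_competitor = bounded_field I u K
  for I :: "real set" and u :: "real \<Rightarrow> real ^ 'n \<Rightarrow> real" and K :: real +
  fixes \<Omega> :: "(real ^ 'n) set" and s t0 :: real and w :: "real ^ 'n \<Rightarrow> real"
  assumes \<Omega>: "open \<Omega>" "bounded \<Omega>"
    and s: "0 < s" "s < 1"
    and t0: "t0 \<in> I"
    and w: "w \<in> admissible I u"
    and exterior: "same_dirichlet \<Omega> w (u t0)"
begin

lemma continuous_w: "continuous_on S w"
  using w continuous_on_subset by (auto simp: admissible_def)

lemma measurable_w [measurable]: "w \<in> borel_measurable borel"
  by (intro borel_measurable_continuous_onI continuous_w)

lemma measurable_u0 [measurable]: "u t0 \<in> borel_measurable borel"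
  using measurable_leaf[OF t0] .

lemma graph_w: "(x, w x) \<in> field_region I u"
  using w by (auto simp: admissible_def)

lemma K_nonneg: "0 \<le> K"
  using bound[OF t0, of undefined] by linarith

lemma w_bound: "\<bar>w x\<bar> \<le> K"
  using graph_w[of x] bound by (auto simp: field_region_def)

lemma w_exterior: "x \<notin> \<Omega> \<Longrightarrow> w x = u t0 x"
  using exterior by (auto simp: same_dirichlet_def)

lemma \<Omega>_measurable [measurable]: "\<Omega> \<in> sets borel"
  using \<Omega>(1) by simp

lemma \<Omega>_integrable: "integrable lborel (indicator \<Omega> :: real ^ 'n \<Rightarrow> real)"
  using emeasure_bounded_finite[OF \<Omega>(2)] by (auto intro: integrable_real_indicator)

text \<open>
  The oriented integral over \<open>l\<close> from \<open>u t0 x\<close> to \<open>w x\<close> is an ordinary integral against this density; in this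
  form Fubini's theorem applies without splitting according to the sign of \<open>w x - u t0 x\<close>.
\<close>

definition layer :: "real ^ 'n \<Rightarrow> real \<Rightarrow> real" where
  "layer x l = indicator {u t0 x<..<w x} l - indicator {w x<..<u t0 x} l"

lemma layer_abs_le: "\<bar>layer x l\<bar> \<le> 1"
  by (auto simp: layer_def indicator_def)

lemma layer_nonzero_between:
  "layer x l \<noteq> 0 \<Longrightarrow> u t0 x < l \<and> l < w x \<or> w x < l \<and> l < u t0 x"
  by (auto simp: layer_def indicator_def split: if_splits)

lemma layer_nonzero:
  assumes "layer x l \<noteq> 0"
  shows "x \<in> \<Omega>" "l \<in> {-K..K}" "(x, l) \<in> field_region I u"
proof -
  have c: "u t0 x < l \<and> l < w x \<or> w x < l \<and> l < u t0 x"
    using layer_nonzero_between[OF assms] .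
  then show "x \<in> \<Omega>" using w_exterior[of x] by fastforce
  show "l \<in> {-K..K}" using c w_bound[of x] bound[OF t0, of x] by auto
  show "(x, l) \<in> field_region I u"
    using c field_region_between[OF graph_leaf[OF t0] graph_w, of x l]
      field_region_between[OF graph_w graph_leaf[OF t0], of x l] by auto
qed

lemma measurable_layer [measurable]:
  assumes [measurable]: "f \<in> M \<rightarrow>\<^sub>M borel" "g \<in> M \<rightarrow>\<^sub>M borel"
  shows "(\<lambda>p. layer (f p) (g p)) \<in> borel_measurable M"
proof -
  have "(\<lambda>p. layer (f p) (g p))
      = (\<lambda>p. (if u t0 (f p) < g p \<and> g p < w (f p) then 1 else 0)
           - (if w (f p) < g p \<and> g p < u t0 (f p) then 1 else 0))"
    by (auto simp: layer_def fun_eq_iff)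
  then show ?thesis by simp
qed

lemma interval_integral_eq_layer:
  "(LBINT l=ereal (u t0 x)..ereal (w x). f l) = (\<integral>l. layer x l * f l \<partial>lborel)"
proof (cases "u t0 x \<le> w x")
  case True
  then have "layer x l = indicator {u t0 x<..<w x} l" for l by (simp add: layer_def)
  then show ?thesis using True
    by (simp add: interval_lebesgue_integral_def set_lebesgue_integral_def)
next
  case False
  then have "layer x l = - indicator {w x<..<u t0 x} l" for l by (simp add: layer_def)
  then show ?thesis using False
    by (simp add: interval_lebesgue_integral_def set_lebesgue_integral_def)
qed

definition layer_gap :: "real ^ 'n \<Rightarrow> real ^ 'n \<Rightarrow> real \<Rightarrow> real" where
  "layer_gap x y l = layer x l * gap x y l"

lemma layer_gap_bound: "\<bar>layer_gap x y l\<bar> \<le> 2 * K * (indicator \<Omega> x * indicator {-K..K} l)"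
proof (cases "layer x l = 0")
  case True
  then show ?thesis using K_nonneg by (simp add: layer_gap_def)
next
  case False
  note n = layer_nonzero[OF False]
  have "\<bar>gap x y l\<bar> \<le> 2 * K"
    using n(2) bound[OF leaf_param(1)[OF n(3)], of y] by (auto simp: gap_def)
  then have "\<bar>layer x l\<bar> * \<bar>gap x y l\<bar> \<le> 1 * (2 * K)"
    using layer_abs_le by (intro mult_mono) auto
  then show ?thesis using n by (simp add: layer_gap_def abs_mult)
qed

text \<open>
  The leaf parameter is only meaningful on the field region, which need not be open. The layer,
  however, is supported in the open set of points strictly between the two graphs, where the gap is
  continuous.
\<close>

lemma measurable_layer_gap [measurable]:
  assumes [measurable]: "f \<in> M \<rightarrow>\<^sub>M borel" "g \<in> M \<rightarrow>\<^sub>M borel" "h \<in> M \<rightarrow>\<^sub>M borel"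
  shows "(\<lambda>p. layer_gap (f p) (g p) (h p)) \<in> borel_measurable M"
proof -
  let ?O = "{p :: (real ^ 'n) \<times> (real ^ 'n) \<times> real.
      u t0 (fst p) < snd (snd p) \<and> snd (snd p) < w (fst p)} \<union>
    {p. w (fst p) < snd (snd p) \<and> snd (snd p) < u t0 (fst p)}"
  have c: "continuous_on UNIV (\<lambda>p :: (real ^ 'n) \<times> (real ^ 'n) \<times> real. w (fst p))"
     "continuous_on UNIV (\<lambda>p :: (real ^ 'n) \<times> (real ^ 'n) \<times> real. u t0 (fst p))"
    by (auto intro!: continuous_on_compose2[OF continuous_w[of UNIV]]
      continuous_on_compose2[OF continuous_leaf[OF t0, of UNIV]] continuous_intros)
  have o: "open ?O"
    by (intro open_Un open_Collect_conj open_Collect_less c continuous_intros)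
  have r: "(fst p, snd (snd p)) \<in> field_region I u" if "p \<in> ?O" for p
    using that field_region_between[OF graph_leaf[OF t0] graph_w, of "fst p" "snd (snd p)"]
      field_region_between[OF graph_w graph_leaf[OF t0], of "fst p" "snd (snd p)"] by auto
  have cg: "continuous_on ?O (\<lambda>p. gap (fst p) (fst (snd p)) (snd (snd p)))"
    unfolding gap_def
    by (intro continuous_intros continuous_field_compose continuous_leaf_param_compose)
      (use r leaf_param(1) in blast)+
  define \<Phi> where "\<Phi> p = indicator ?O p *\<^sub>R gap (fst p) (fst (snd p)) (snd (snd p))" for p
  have "\<Phi> \<in> borel_measurable borel"
    unfolding \<Phi>_def[abs_def] using o by (intro borel_measurable_continuous_on_indicator cg) auto
  then have m: "\<Phi> \<in> borel_measurable (borel \<Otimes>\<^sub>M borel \<Otimes>\<^sub>M borel)"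
    by (simp add: borel_prod)
  have t: "(\<lambda>q. (f q, g q, h q)) \<in> M \<rightarrow>\<^sub>M borel \<Otimes>\<^sub>M borel \<Otimes>\<^sub>M borel"
    by measurable
  have [measurable]: "(\<lambda>q. \<Phi> (f q, g q, h q)) \<in> borel_measurable M"
    using measurable_compose[OF t m] .
  have "(\<lambda>q. layer (f q) (h q) * \<Phi> (f q, g q, h q)) \<in> borel_measurable M" by measurable
  moreover have "layer x l * \<Phi> (x, y, l) = layer_gap x y l" for x y l
    by (auto simp: \<Phi>_def layer_gap_def layer_def indicator_def)
  ultimately show ?thesis by simp
qed

text \<open>
  The inner integral of the calibration without its singular kernel; see \<open>inner_integral_eq_gap_mass\<close>.
\<close>

definition gap_mass :: "real ^ 'n \<Rightarrow> real ^ 'n \<Rightarrow> real" where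
  "gap_mass x y = (\<integral>l. layer_gap x y l \<partial>lborel)"

lemma integrable_box: "integrable lborel (\<lambda>l :: real. (c :: real) * indicator {-K..K} l)"
  by (intro integrable_mult_right integrable_real_indicator) (auto simp: emeasure_lborel_Icc_eq)

lemma integral_box: "(\<integral>l. c * indicator {-K..K} l \<partial>lborel) = 2 * K * c"
  using K_nonneg by simp

lemma integrable_layer_gap: "integrable lborel (layer_gap x y)"
proof (rule Bochner_Integration.integrable_bound[OF integrable_box[of "2 * K * indicator \<Omega> x"]])
  show "AE l in lborel. norm (layer_gap x y l) \<le> norm (2 * K * indicator \<Omega> x * indicator {-K..K} l)"
    using order_trans[OF layer_gap_bound abs_ge_self] by (intro AE_I2) (simp add: mult.assoc)
qed measurable

lemma measurable_gap_mass [measurable]: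
  assumes [measurable]: "f \<in> M \<rightarrow>\<^sub>M borel" "g \<in> M \<rightarrow>\<^sub>M borel"
  shows "(\<lambda>p. gap_mass (f p) (g p)) \<in> borel_measurable M"
  unfolding gap_mass_def[abs_def] by measurable

lemma gap_mass_bound: "\<bar>gap_mass x y\<bar> \<le> 4 * K\<^sup>2 * indicator \<Omega> x"
proof -
  have "\<bar>gap_mass x y\<bar> \<le> (\<integral>l. 2 * K * indicator \<Omega> x * indicator {-K..K} l \<partial>lborel)"
    unfolding gap_mass_def using layer_gap_bound
    by (intro integral_abs_bound_integral integrable_layer_gap integrable_box) (simp add: mult.assoc)
  then show ?thesis unfolding integral_box by (simp add: power2_eq_square mult.assoc)
qed

lemma gap_mass_eq_gap_integral: "gap_mass x y = gap_integral t0 (leaf_param I u x (w x)) x y"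
  unfolding gap_mass_def layer_gap_def gap_integral_def leaf_param(2)[OF graph_w]
  by (rule interval_integral_eq_layer[symmetric])

text \<open>
  \<open>gap_integral_young\<close> for the leaves through \<open>(x, w x)\<close> and \<open>(y, w y)\<close>.
\<close>

lemma gap_mass_young: "gap_mass x y + gap_mass y x \<le> (\<bar>w x - w y\<bar>\<^sup>2 - \<bar>u t0 x - u t0 y\<bar>\<^sup>2) / 2"
  using gap_integral_young[OF t0 leaf_param(1)[OF graph_w] leaf_param(1)[OF graph_w], of x x y y]
  by (simp add: gap_mass_eq_gap_integral leaf_param(2)[OF graph_w])

lemma inner_integral_eq_gap_mass:
  "inner_integral s I u t0 w x y = gap_mass x y / norm (x - y) powr (real CARD('n) + 2 * s)"
proof -
  have "inner_integral s I u t0 w x y = (\<integral>l. layer x l * leaf_quotient s I u x y l \<partial>lborel)"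
    unfolding inner_integral_def by (rule interval_integral_eq_layer)
  also have "\<dots> = (\<integral>l. layer_gap x y l / norm (x - y) powr (real CARD('n) + 2 * s) \<partial>lborel)"
  proof (intro Bochner_Integration.integral_cong refl)
    fix l
    show "layer x l * leaf_quotient s I u x y l = layer_gap x y l / norm (x - y) powr (real CARD('n) + 2 * s)"
      using leaf_param(2)[OF layer_nonzero(3)[of x l]]
      by (cases "layer x l = 0") (simp_all add: layer_gap_def leaf_quotient_def Let_def gap_def)
  qed
  also have "\<dots> = gap_mass x y / norm (x - y) powr (real CARD('n) + 2 * s)"
    by (simp add: gap_mass_def)
  finally show ?thesis .
qed

definition trunc_kernel :: "real \<Rightarrow> real ^ 'n \<Rightarrow> real" where
  "trunc_kernel \<epsilon> z = indicator {z. \<epsilon> \<le> norm z} z / norm z powr (real CARD('n) + 2 * s)"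

lemma trunc_kernel_nonneg: "0 \<le> trunc_kernel \<epsilon> z"
  by (simp add: trunc_kernel_def)

lemma trunc_kernel_minus: "trunc_kernel \<epsilon> (x - y) = trunc_kernel \<epsilon> (y - x)"
  by (simp add: trunc_kernel_def norm_minus_commute indicator_def)

lemma measurable_trunc_kernel [measurable]: "trunc_kernel \<epsilon> \<in> borel_measurable borel"
  unfolding trunc_kernel_def[abs_def] by measurable

lemma integrable_trunc_kernel: "0 < \<epsilon> \<Longrightarrow> integrable lborel (trunc_kernel \<epsilon>)"
  unfolding trunc_kernel_def[abs_def] using truncated_kernel_integrable[OF s] .

lemma integrable_gap_mass: 
  assumes "0 < \<epsilon>"
  shows "integrable lborel (\<lambda>(x, y). trunc_kernel \<epsilon> (x - y) * gap_mass x y)"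
proof (rule Bochner_Integration.integrable_bound)
  show "integrable lborel (\<lambda>p. 4 * K\<^sup>2 * (case p of (x, y) \<Rightarrow> indicator \<Omega> x * trunc_kernel \<epsilon> (x - y)))"
    by (intro integrable_mult_right integrable_lborel_convolution \<Omega>_integrable integrable_trunc_kernel assms)
  show "(\<lambda>(x, y). trunc_kernel \<epsilon> (x - y) * gap_mass x y) \<in> borel_measurable lborel"
    by (rule measurable_lborel_pair) measurable
  have "\<bar>trunc_kernel \<epsilon> (x - y) * gap_mass x y\<bar> \<le> 4 * K\<^sup>2 * (indicator \<Omega> x * trunc_kernel \<epsilon> (x - y))" for x y
    using mult_left_mono[OF gap_mass_bound trunc_kernel_nonneg, of \<epsilon> "x - y" x y]
    by (simp add: abs_mult trunc_kernel_nonneg mult_ac)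
  then show "AE p in lborel. norm (case p of (x, y) \<Rightarrow> trunc_kernel \<epsilon> (x - y) * gap_mass x y)
      \<le> norm (4 * K\<^sup>2 * (case p of (x, y) \<Rightarrow> indicator \<Omega> x * trunc_kernel \<epsilon> (x - y)))"
    using order_trans[OF _ abs_ge_self] by (intro AE_I2) (auto split: prod.split)
qed

text \<open>
  The restriction to \<^const>\<open>Q_region\<close> may be dropped: the inner integral already vanishes when \<open>x\<close> is
  outside \<open>\<Omega>\<close>, where \<open>w\<close> and \<open>u t0\<close> agree.
\<close>

lemma Q_trunc_gap_mass:
  "indicator (Q_trunc \<Omega> \<epsilon>) (x, y) * inner_integral s I u t0 w x y = trunc_kernel \<epsilon> (x - y) * gap_mass x y"
  using gap_mass_bound[of x y]
  by (cases "x \<in> \<Omega>") (auto simp: inner_integral_eq_gap_mass trunc_kernel_def Q_trunc_def Q_region_def indicator_def)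

lemma set_integrable_inner_integral:
  "0 < \<epsilon> \<Longrightarrow> set_integrable lborel (Q_trunc \<Omega> \<epsilon>) (\<lambda>(x, y). inner_integral s I u t0 w x y)"
proof -
  have "(\<lambda>p. indicator (Q_trunc \<Omega> \<epsilon>) p *\<^sub>R (case p of (x, y) \<Rightarrow> inner_integral s I u t0 w x y))
      = (\<lambda>(x, y). trunc_kernel \<epsilon> (x - y) * gap_mass x y)"
    by (auto simp: fun_eq_iff Q_trunc_gap_mass)
  then show "0 < \<epsilon> \<Longrightarrow> ?thesis"
    using integrable_gap_mass[of \<epsilon>] by (simp only: set_integrable_def)
qed

lemma trunc_integral_eq:
  "trunc_integral s I \<Omega> u t0 w \<epsilon> = (\<integral>(x, y). trunc_kernel \<epsilon> (x - y) * gap_mass x y \<partial>lborel)"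
  unfolding trunc_integral_def set_lebesgue_integral_def
  by (intro Bochner_Integration.integral_cong) (auto simp: Q_trunc_gap_mass)

text \<open>
  The parameters are values of the continuous leaf parameter on the closed region between the two
  graphs over the closure of \<open>\<Omega>\<close>, which is bounded and contained in the field region. This
  compactness is what makes the estimates on the leaves uniform.
\<close>

lemma leaf_params_compact:
  obtains J where "compact J" "J \<subseteq> I" "\<And>x l. layer x l \<noteq> 0 \<Longrightarrow> leaf_param I u x l \<in> J"
proof -
  define S where "S = {p. fst p \<in> closure \<Omega> \<and> min (u t0 (fst p)) (w (fst p)) \<le> snd p
      \<and> snd p \<le> max (u t0 (fst p)) (w (fst p))}"
  have sub: "S \<subseteq> closure \<Omega> \<times> {-K..K}"
  proof
    fix p assume "p \<in> S"
    then show "p \<in> closure \<Omega> \<times> {-K..K}"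
      using w_bound[of "fst p"] bound[OF t0, of "fst p"]
      by (cases p) (auto simp: S_def min_def max_def abs_le_iff split: if_splits)
  qed
  have c: "continuous_on UNIV (\<lambda>p :: (real ^ 'n) \<times> real. w (fst p))"
     "continuous_on UNIV (\<lambda>p :: (real ^ 'n) \<times> real. u t0 (fst p))"
    by (auto intro!: continuous_on_compose2[OF continuous_w[of UNIV]]
      continuous_on_compose2[OF continuous_leaf[OF t0, of UNIV]] continuous_intros)
  have "closed (fst -` closure \<Omega> :: ((real ^ 'n) \<times> real) set)" 
    by (intro closed_vimage continuous_intros) auto
  then have "closed S"
    unfolding S_def
    by (intro closed_Collect_conj closed_Collect_le continuous_intros c) (simp_all add: vimage_def)
  moreover have "bounded S"
    using sub \<Omega>(2) by (auto intro!: bounded_subset[OF _ sub] bounded_Times bounded_closure)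
  ultimately have S: "compact S" by (simp add: compact_eq_bounded_closed)
  have G: "S \<subseteq> field_region I u"
  proof
    fix p assume "p \<in> S"
    moreover have "(fst p, min (u t0 (fst p)) (w (fst p))) \<in> field_region I u"
      "(fst p, max (u t0 (fst p)) (w (fst p))) \<in> field_region I u"
      using graph_leaf[OF t0] graph_w by (auto simp: min_def max_def)
    ultimately show "p \<in> field_region I u"
      using field_region_between[of "fst p" _ _ "snd p"] by (auto simp: S_def)
  qed
  show ?thesis
  proof (rule that)
    show "compact ((\<lambda>(x, l). leaf_param I u x l) ` S)"
      using continuous_on_subset[OF continuous_leaf_param G] S by (rule compact_continuous_image)
    show "(\<lambda>(x, l). leaf_param I u x l) ` S \<subseteq> I" using G leaf_param(1) by auto
    fix x l assume l: "layer x l \<noteq> 0"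
    then have "(x, l) \<in> S"
      using layer_nonzero(1)[OF l] closure_subset[of \<Omega>] layer_nonzero_between[OF l]
      by (auto simp: S_def)
    then show "leaf_param I u x l \<in> (\<lambda>(x, l). leaf_param I u x l) ` S" by force
  qed
qed

text \<open>
  The inner integral, at a point \<open>x\<close>, in the expression of the principal value through fractional
  Laplacians; the normalizing constant is set to \<open>1\<close> so that it can be factored out.
\<close>

definition pv_density :: "real ^ 'n \<Rightarrow> real" where
  "pv_density x = (\<integral>l. layer x l * frac_laplacian 1 s (u (leaf_param I u x l)) x \<partial>lborel)"

text \<open>
  Integrating in \<open>y\<close> at fixed \<open>(x, l)\<close> freezes the leaf, and leaves its truncated fractional Laplacian
  at \<open>x\<close>.
\<close>

lemma slice_integral:
  assumes "0 < \<epsilon>"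
  shows "(\<integral>y. trunc_kernel \<epsilon> (x - y) * layer_gap x y l \<partial>lborel)
     = layer x l * trunc_laplacian s \<epsilon> (u (leaf_param I u x l)) x"
proof (cases "layer x l = 0")
  case True
  then show ?thesis by (simp add: layer_gap_def)
next
  case False
  then have l: "u (leaf_param I u x l) x = l" using leaf_param(2) layer_nonzero by blast
  have "(\<integral>y. trunc_kernel \<epsilon> (x - y) * layer_gap x y l \<partial>lborel)
    = (\<integral>y. layer x l * (trunc_kernel \<epsilon> (x - y) * gap x y l) \<partial>lborel)"
    by (simp add: layer_gap_def mult_ac)
  also have "\<dots> = layer x l * (\<integral>y. trunc_kernel \<epsilon> (x - y) * gap x y l \<partial>lborel)" by simp
  also have "(\<integral>y. trunc_kernel \<epsilon> (x - y) * gap x y l \<partial>lborel) = trunc_laplacian s \<epsilon> (u (leaf_param I u x l)) x"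
    unfolding trunc_laplacian_def set_lebesgue_integral_def
    by (intro Bochner_Integration.integral_cong)
      (auto simp: trunc_kernel_def gap_def l indicator_def)
  finally show ?thesis .
qed

text \<open>
  For a positive truncation Fubini's theorem allows integration in \<open>y\<close> first. The truncated
  Laplacians that appear are bounded uniformly in \<open>x\<close>, \<open>l\<close> and the truncation by \<open>second_diff_bound\<close>, so
  dominated convergence applies first in \<open>l\<close> and then in \<open>x\<close>.
\<close>

lemma trunc_integral_tendsto:
  shows "integrable lborel (\<lambda>l. layer x l * frac_laplacian 1 s (u (leaf_param I u x l)) x)"
    and "integrable lborel pv_density"
    and "(trunc_integral s I \<Omega> u t0 w \<longlongrightarrow> (\<integral>x. pv_density x \<partial>lborel)) (at_right 0)"
proof -
  obtain J where J: "compact J" "J \<subseteq> I" "\<And>x l. layer x l \<noteq> 0 \<Longrightarrow> leaf_param I u x l \<in> J"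
    using leaf_params_compact by metis
  obtain B where B: "0 \<le> B"
    "\<And>t x z. t \<in> J \<Longrightarrow> x \<in> \<Omega> \<Longrightarrow> \<bar>second_diff (u t) x z\<bar> \<le> B * min 1 ((norm z)\<^sup>2)"
    using second_diff_bound[OF J(1,2) \<Omega>(2)] by metis
  define C where "C = B * (\<integral>z. levy_weight s (z :: real ^ 'n) \<partial>lborel)"
  have C: "0 \<le> C" using B(1) by (simp add: C_def levy_weight_nonneg)
  let ?T = "\<lambda>\<epsilon> x l. layer x l * trunc_laplacian s \<epsilon> (u (leaf_param I u x l)) x"
  have T_bound: "\<bar>?T \<epsilon> x l\<bar> \<le> C * indicator \<Omega> x * indicator {-K..K} l" if \<epsilon>: "0 < \<epsilon>" for \<epsilon> x l
  proof (cases "layer x l = 0")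
    case True
    then show ?thesis using C by simp
  next
    case False
    note n = layer_nonzero[OF False]
    have "\<bar>trunc_laplacian s \<epsilon> (u (leaf_param I u x l)) x\<bar> \<le> C"
      unfolding C_def using n J(2) J(3)[OF False]
      by (intro trunc_laplacian_bounded_tendsto(1)[OF s _ bound B(2) \<epsilon>] measurable_leaf) auto
    then have "\<bar>layer x l\<bar> * \<bar>trunc_laplacian s \<epsilon> (u (leaf_param I u x l)) x\<bar> \<le> 1 * C"
      using layer_abs_le by (intro mult_mono) auto
    then show ?thesis using n by (simp add: abs_mult)
  qed
  have T_lim: "((\<lambda>\<epsilon>. ?T \<epsilon> x l) \<longlongrightarrow> layer x l * frac_laplacian 1 s (u (leaf_param I u x l)) x) (at_right 0)" for x l
  proof (cases "layer x l = 0")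
    case False
    note n = layer_nonzero[OF False]
    show ?thesis using n J(2) J(3)[OF False]
      by (intro tendsto_intros trunc_laplacian_bounded_tendsto(2)[OF s _ bound B(2)] measurable_leaf) auto
  qed simp
  let ?M = "\<lambda>\<epsilon> x. \<integral>y. trunc_kernel \<epsilon> (x - y) * gap_mass x y \<partial>lborel"
  have fub: "?M \<epsilon> x = (\<integral>l. ?T \<epsilon> x l \<partial>lborel)" if \<epsilon>: "0 < \<epsilon>" for \<epsilon> x
  proof -
    have int: "integrable lborel (\<lambda>(l, y). trunc_kernel \<epsilon> (x - y) * layer_gap x y l)"
    proof (rule Bochner_Integration.integrable_bound)
      show "integrable lborel (\<lambda>(l, y). (2 * K * indicator {-K..K} l) * trunc_kernel \<epsilon> (x - y))"
        using integrable_trunc_kernel[OF \<epsilon>]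
        by (intro integrable_lborel_product integrable_box) (simp add: lborel_integral_shift_reflect)
      show "(\<lambda>(l, y). trunc_kernel \<epsilon> (x - y) * layer_gap x y l) \<in> borel_measurable lborel"
        by (rule measurable_lborel_pair) measurable
      have "\<bar>trunc_kernel \<epsilon> (x - y) * layer_gap x y l\<bar> \<le> (2 * K * indicator {-K..K} l) * trunc_kernel \<epsilon> (x - y)" for y l
      proof -
        have "\<bar>layer_gap x y l\<bar> \<le> 2 * K * indicator {-K..K} l"
          using layer_gap_bound[of x y l] K_nonneg by (cases "x \<in> \<Omega>") auto
        from mult_left_mono[OF this trunc_kernel_nonneg, of \<epsilon> "x - y"]
        show ?thesis by (simp add: abs_mult trunc_kernel_nonneg mult_ac)
      qed
      then show "AE p in lborel. norm (case p of (l, y) \<Rightarrow> trunc_kernel \<epsilon> (x - y) * layer_gap x y l)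
          \<le> norm (case p of (l, y) \<Rightarrow> (2 * K * indicator {-K..K} l) * trunc_kernel \<epsilon> (x - y))"
        using order_trans[OF _ abs_ge_self] by (intro AE_I2) (auto split: prod.split)
    qed
    have "?M \<epsilon> x = (\<integral>y. \<integral>l. trunc_kernel \<epsilon> (x - y) * layer_gap x y l \<partial>lborel \<partial>lborel)"
      by (simp add: gap_mass_def)
    also have "\<dots> = (\<integral>l. \<integral>y. trunc_kernel \<epsilon> (x - y) * layer_gap x y l \<partial>lborel \<partial>lborel)"
      using int by (intro lborel_pair.Fubini_integral) (simp add: lborel_prod)
    also have "\<dots> = (\<integral>l. ?T \<epsilon> x l \<partial>lborel)" by (simp add: slice_integral[OF \<epsilon>])
    finally show ?thesis .
  qed
  have Tm: "?T \<epsilon> x \<in> borel_measurable lborel" if "0 < \<epsilon>" for \<epsilon> x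
    unfolding slice_integral[OF that, symmetric] by measurable
  show "integrable lborel (\<lambda>l. layer x l * frac_laplacian 1 s (u (leaf_param I u x l)) x)"
    by (rule dominated_at_right_zero(1)[of "\<lambda>\<epsilon>. ?T \<epsilon> x" lborel,
          OF Tm T_lim T_bound integrable_box])
  have lim: "((\<lambda>\<epsilon>. ?M \<epsilon> x) \<longlongrightarrow> pv_density x) (at_right 0)" for x
  proof (rule Lim_transform_eventually)
    show "((\<lambda>\<epsilon>. \<integral>l. ?T \<epsilon> x l \<partial>lborel) \<longlongrightarrow> pv_density x) (at_right 0)"
      unfolding pv_density_def
      by (rule dominated_at_right_zero(2)[of "\<lambda>\<epsilon>. ?T \<epsilon> x" lborel,
          OF Tm T_lim T_bound integrable_box])
    show "\<forall>\<^sub>F \<epsilon> in at_right 0. (\<integral>l. ?T \<epsilon> x l \<partial>lborel) = ?M \<epsilon> x"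
      by (intro eventually_mono[OF eventually_at_right_less]) (simp add: fub)
  qed
  have Mb: "\<bar>?M \<epsilon> x\<bar> \<le> 2 * K * C * indicator \<Omega> x" if \<epsilon>: "0 < \<epsilon>" for \<epsilon> x
  proof -
    have "\<bar>\<integral>l. ?T \<epsilon> x l \<partial>lborel\<bar> \<le> (\<integral>l. C * indicator \<Omega> x * indicator {-K..K} l \<partial>lborel)"
      using T_bound[OF \<epsilon>] Tm[OF \<epsilon>, of x]
      by (intro integral_abs_bound_integral integrable_box
           Bochner_Integration.integrable_bound[OF integrable_box[of "C * indicator \<Omega> x"]] AE_I2)
         (auto intro: order_trans[OF _ abs_ge_self])
    then show ?thesis unfolding integral_box fub[OF \<epsilon>] by (simp add: mult.assoc)
  qed
  have Mm: "?M \<epsilon> \<in> borel_measurable lborel" for \<epsilon>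
    by measurable
  have \<Omega>i: "integrable lborel (\<lambda>x :: real ^ 'n. 2 * K * C * indicator \<Omega> x)"
    by (intro integrable_mult_right \<Omega>_integrable)
  show "integrable lborel pv_density"
    by (rule dominated_at_right_zero(1)[of ?M lborel, OF Mm lim Mb \<Omega>i])
  have "((\<lambda>\<epsilon>. \<integral>x. ?M \<epsilon> x \<partial>lborel) \<longlongrightarrow> (\<integral>x. pv_density x \<partial>lborel)) (at_right 0)"
    by (rule dominated_at_right_zero(2)[of ?M lborel, OF Mm lim Mb \<Omega>i])
  moreover have "(\<integral>x. ?M \<epsilon> x \<partial>lborel) = trunc_integral s I \<Omega> u t0 w \<epsilon>" if "0 < \<epsilon>" for \<epsilon>
    using lborel_pair.integral_fst'[of "\<lambda>(x, y). trunc_kernel \<epsilon> (x - y) * gap_mass x y"] integrable_gap_mass[OF that]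
    by (simp add: lborel_prod trunc_integral_eq)
  then have "\<forall>\<^sub>F \<epsilon> in at_right 0. (\<integral>x. ?M \<epsilon> x \<partial>lborel) = trunc_integral s I \<Omega> u t0 w \<epsilon>"
    by (intro eventually_mono[OF eventually_at_right_less])
  ultimately show "(trunc_integral s I \<Omega> u t0 w \<longlongrightarrow> (\<integral>x. pv_density x \<partial>lborel)) (at_right 0)"
    by (rule Lim_transform_eventually)
qed

end

section \<open>Energy and calibration functional\<close>

definition gagliardo :: "real \<Rightarrow> (real ^ 'n) set \<Rightarrow> (real ^ 'n \<Rightarrow> real) \<Rightarrow> real" where
  "gagliardo s \<Omega> v = (LINT (x, y):Q_region \<Omega>|lborel.
     \<bar>v x - v y\<bar>\<^sup>2 / norm (x - y) powr (real CARD('n) + 2 * s))"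

definition finite_gagliardo :: "real \<Rightarrow> (real ^ 'n) set \<Rightarrow> (real ^ 'n \<Rightarrow> real) \<Rightarrow> bool" where
  "finite_gagliardo s \<Omega> v \<longleftrightarrow> set_integrable lborel (Q_region \<Omega>)
     (\<lambda>(x, y). \<bar>v x - v y\<bar>\<^sup>2 / norm (x - y) powr (real CARD('n) + 2 * s))"

lemma nn_gagliardo_eq:
  fixes v :: "real ^ 'n \<Rightarrow> real"
  shows "(\<integral>\<^sup>+(x, y)\<in>Q_region \<Omega>. ennreal (\<bar>v x - v y\<bar>\<^sup>2 / norm (x - y) powr (real CARD('n) + 2 * s)) \<partial>lborel)
    = (\<integral>\<^sup>+p. ennreal (indicator (Q_region \<Omega>) p *\<^sub>R
        (case p of (x, y) \<Rightarrow> \<bar>v x - v y\<bar>\<^sup>2 / norm (x - y) powr (real CARD('n) + 2 * s))) \<partial>lborel)"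
  by (intro nn_integral_cong) (auto simp: indicator_def)

lemma energy_finite:
  fixes v :: "real ^ 'n \<Rightarrow> real"
  assumes "finite_gagliardo s \<Omega> v"
  shows "energy c s F \<Omega> v = ereal (c / 4 * gagliardo s \<Omega> v - (LINT x:\<Omega>|lborel. F (v x)))"
proof -
  have "(\<integral>\<^sup>+p. ennreal (indicator (Q_region \<Omega>) p *\<^sub>R
        (case p of (x, y) \<Rightarrow> \<bar>v x - v y\<bar>\<^sup>2 / norm (x - y) powr (real CARD('n) + 2 * s))) \<partial>lborel)
      = ennreal (gagliardo s \<Omega> v)"
    using assms unfolding gagliardo_def finite_gagliardo_def set_lebesgue_integral_def set_integrable_def
    by (intro nn_integral_eq_integral) (auto intro!: AE_I2)
  moreover have "0 \<le> gagliardo s \<Omega> v"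
    unfolding gagliardo_def set_lebesgue_integral_def by (intro Bochner_Integration.integral_nonneg) auto
  ultimately show ?thesis
    unfolding energy_def nn_gagliardo_eq by (simp add: enn2ereal_ennreal)
qed

lemma energy_infinite:
  fixes v :: "real ^ 'n \<Rightarrow> real"
  assumes [measurable]: "v \<in> borel_measurable borel" "\<Omega> \<in> sets borel"
    and "0 < c" and nf: "\<not> finite_gagliardo s \<Omega> v"
  shows "energy c s F \<Omega> v = \<infinity>"
proof -
  let ?f = "\<lambda>p. indicator (Q_region \<Omega>) p *\<^sub>R
        (case p of (x, y) \<Rightarrow> \<bar>v x - v y\<bar>\<^sup>2 / norm (x - y) powr (real CARD('n) + 2 * s))"
  have Q: "Q_region \<Omega> = {p. fst p \<in> \<Omega> \<or> snd p \<in> \<Omega>}" by (auto simp: Q_region_def)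
  have "?f \<in> borel_measurable (borel \<Otimes>\<^sub>M borel)"
    unfolding Q by measurable
  then have "?f \<in> borel_measurable lborel" by (rule measurable_lborel_pair)
  then have "integrable lborel ?f" if "(\<integral>\<^sup>+p. ennreal (?f p) \<partial>lborel) < \<infinity>"
    using that by (intro integrableI_nonneg AE_I2) auto
  then have "\<not> (\<integral>\<^sup>+p. ennreal (?f p) \<partial>lborel) < \<infinity>"
    using nf unfolding finite_gagliardo_def set_integrable_def by blast
  then have "(\<integral>\<^sup>+p. ennreal (?f p) \<partial>lborel) = \<infinity>"
    by (simp only: infinity_ennreal_def not_less top_le)
  then show ?thesis
    using \<open>0 < c\<close> unfolding energy_def nn_gagliardo_eq by simp
qed

context bounded_field
begin

lemma leaf_admissible:
  assumes "t \<in> I"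
  shows "u t \<in> admissible I u"
  unfolding admissible_def L_infinity_def
  using assms continuous_leaf measurable_leaf bound[OF assms] graph_leaf by (auto intro!: exI[of _ K])

text \<open>
  Each pair in \<^const>\<open>Q_region\<close> has a point in \<open>\<Omega>\<close>, and there the squared difference is at most a
  multiple of \<open>min 1 ((norm (x - y))\<^sup>2)\<close>, since the leaf is Lipschitz near the bounded set \<open>\<Omega>\<close> and bounded
  globally.
\<close>

lemma leaf_finite_gagliardo:
  fixes \<Omega> :: "(real ^ 'n) set"
  assumes t: "t \<in> I" and s: "0 < s" "s < 1" and \<Omega>: "open \<Omega>" "bounded \<Omega>"
  shows "finite_gagliardo s \<Omega> (u t)"
proof -
  let ?q = "\<lambda>(x, y). \<bar>u t x - u t y\<bar>\<^sup>2 / norm (x - y) powr (real CARD('n) + 2 * s)"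
  have [measurable]: "u t \<in> borel_measurable borel" "\<Omega> \<in> sets borel"
    using measurable_leaf[OF t] \<Omega>(1) by auto
  obtain M where M: "0 \<le> M"
    "\<And>x y. x \<in> \<Omega> \<Longrightarrow> \<bar>u t x - u t y\<bar>\<^sup>2 \<le> M * min 1 ((norm (x - y))\<^sup>2)"
    using leaf_difference_bound[OF t \<Omega>(2)] by metis
  let ?h = "\<lambda>(x, y). indicator \<Omega> x * levy_weight s (x - y :: real ^ 'n)"
  have h: "integrable lborel ?h"
    using emeasure_bounded_finite[OF \<Omega>(2)]
    by (intro integrable_lborel_convolution integrable_levy_weight s integrable_real_indicator) auto
  have h': "integrable lborel (\<lambda>(x, y). ?h (y, x))"
    using lborel_pair.integrable_product_swap[of ?h] h by (simp add: lborel_prod)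
  have le: "\<bar>u t x - u t y\<bar>\<^sup>2 / norm (x - y) powr (real CARD('n) + 2 * s) \<le> M * levy_weight s (x - y)"
    if "x \<in> \<Omega>" for x y
    using divide_right_mono[OF M(2)[OF that, of y], of "norm (x - y) powr (real CARD('n) + 2 * s)"]
    by (simp add: levy_weight_def)
  have main: "indicator (Q_region \<Omega>) (x, y) * ?q (x, y) \<le> M * (?h (x, y) + ?h (y, x))" for x y
  proof -
    have h0: "0 \<le> ?h (a, b)" for a b by (simp add: levy_weight_nonneg)
    consider "x \<in> \<Omega>" | "x \<notin> \<Omega>" "y \<in> \<Omega>" | "x \<notin> \<Omega>" "y \<notin> \<Omega>" by blast
    then show ?thesis
    proof cases
      case 1
      then have "indicator (Q_region \<Omega>) (x, y) * ?q (x, y) \<le> M * ?h (x, y)"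
        using le[of x y] by (simp add: Q_region_def)
      also have "\<dots> \<le> M * (?h (x, y) + ?h (y, x))"
        using M(1) h0[of y x] by (intro mult_left_mono) linarith+
      finally show ?thesis .
    next
      case 2
      then show ?thesis
        using le[of y x] by (simp add: Q_region_def abs_minus_commute norm_minus_commute)
    qed (simp add: Q_region_def)
  qed
  show ?thesis
    unfolding finite_gagliardo_def set_integrable_def
  proof (rule Bochner_Integration.integrable_bound)
    show "integrable lborel (\<lambda>p. M * (?h p + (\<lambda>(x, y). ?h (y, x)) p))"
      using h h' by (intro integrable_mult_right Bochner_Integration.integrable_add)
    have Q: "Q_region \<Omega> = {p. fst p \<in> \<Omega> \<or> snd p \<in> \<Omega>}" by (auto simp: Q_region_def)
    show "(\<lambda>p. indicator (Q_region \<Omega>) p *\<^sub>R ?q p) \<in> borel_measurable lborel"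
      unfolding Q by (rule measurable_lborel_pair) measurable
    show "AE p in lborel. norm (indicator (Q_region \<Omega>) p *\<^sub>R ?q p)
        \<le> norm (M * (?h p + (\<lambda>(x, y). ?h (y, x)) p))"
    proof (rule AE_I2)
      fix p :: "(real ^ 'n) \<times> (real ^ 'n)"
      obtain x y where p: "p = (x, y)" by (cases p)
      have "0 \<le> indicator (Q_region \<Omega>) p *\<^sub>R ?q p" by (auto simp: p)
      then show "norm (indicator (Q_region \<Omega>) p *\<^sub>R ?q p)
        \<le> norm (M * (?h p + (\<lambda>(x, y). ?h (y, x)) p))"
        using order_trans[OF main[of x y] abs_ge_self] by (simp add: p)
    qed
  qed
qed

lemma calib_functional_base:
  "calib_functional c s F I \<Omega> u t0 (u t0)
    = c / 4 * gagliardo s \<Omega> (u t0) - (LINT x:\<Omega>|lborel. F (u t0 x))"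
proof -
  have "trunc_integral s I \<Omega> u t0 (u t0) = (\<lambda>_. 0)"
    by (simp add: trunc_integral_def set_lebesgue_integral_def inner_integral_def case_prod_beta fun_eq_iff)
  then have "Lim (at_right 0) (trunc_integral s I \<Omega> u t0 (u t0)) = 0"
    by (simp add: tendsto_Lim)
  then show ?thesis by (simp add: calib_functional_def gagliardo_def)
qed

end

context field_competitor
begin

lemma calib_functional_eq:
  "calib_functional c s F I \<Omega> u t0 w
    = c * (\<integral>x. pv_density x \<partial>lborel) - (LINT x:\<Omega>|lborel. F (w x)) + c / 4 * gagliardo s \<Omega> (u t0)"
  using tendsto_Lim[OF _ trunc_integral_tendsto(3)] by (simp add: calib_functional_def gagliardo_def)

lemma set_integrable_reaction:
  fixes F :: "real \<Rightarrow> real"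
  assumes F: "continuous_on UNIV F"
  shows "set_integrable lborel \<Omega> (\<lambda>x. F (w x))"
proof -
  obtain M where M: "\<And>l. l \<in> {-K..K} \<Longrightarrow> \<bar>F l\<bar> \<le> M"
    using compact_imp_bounded[OF compact_continuous_image[OF continuous_on_subset[OF F subset_UNIV], of "{-K..K}"]]
    unfolding bounded_iff real_norm_def by blast
  have [measurable]: "F \<in> borel_measurable borel" using F by (rule borel_measurable_continuous_onI)
  show ?thesis
    unfolding set_integrable_def
  proof (rule Bochner_Integration.integrable_bound)
    show "integrable lborel (\<lambda>x :: real ^ 'n. M * indicator \<Omega> x)"
      by (intro integrable_mult_right \<Omega>_integrable)
    show "AE x in lborel. norm (indicator \<Omega> x *\<^sub>R F (w x)) \<le> norm (M * indicator \<Omega> x)"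
    proof (rule AE_I2)
      fix x
      have "w x \<in> {-K..K}" using w_bound[of x] by (simp add: abs_le_iff minus_le_iff)
      from M[OF this] show "norm (indicator \<Omega> x *\<^sub>R F (w x)) \<le> norm (M * indicator \<Omega> x)"
        by (simp add: indicator_def)
    qed
  qed measurable
qed

lemma calib_well_defined:
  assumes F: "continuous_on UNIV F"
  shows "calib_well_defined s F I \<Omega> u t0 w"
proof -
  have "interval_lebesgue_integrable lborel (ereal (u t0 x)) (ereal (w x)) (leaf_quotient s I u x y)" for x y
  proof -
    let ?N = "norm (x - y) powr (real CARD('n) + 2 * s)"
    have "interval_lebesgue_integrable lborel (ereal (u t0 x)) (ereal (w x)) (\<lambda>l. gap x y l / ?N)"
      using interval_integrable_gap[OF graph_leaf[OF t0] graph_w, of x y]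
      by (rule interval_lebesgue_integrable_divide)
    moreover have eq: "leaf_quotient s I u x y l = gap x y l / ?N"
      if "u t0 x < l \<and> l < w x \<or> w x < l \<and> l < u t0 x" for l
    proof -
      have "(x, l) \<in> field_region I u"
        using that field_region_between[OF graph_leaf[OF t0] graph_w, of x l]
          field_region_between[OF graph_w graph_leaf[OF t0], of x l] by auto
      then show ?thesis using leaf_param(2) by (simp add: leaf_quotient_def Let_def gap_def)
    qed
    have "set_integrable lborel {u t0 x<..<w x} (leaf_quotient s I u x y)
        \<longleftrightarrow> set_integrable lborel {u t0 x<..<w x} (\<lambda>l. gap x y l / ?N)"
      "set_integrable lborel {w x<..<u t0 x} (leaf_quotient s I u x y)
        \<longleftrightarrow> set_integrable lborel {w x<..<u t0 x} (\<lambda>l. gap x y l / ?N)"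
      by (intro set_integrable_cong; use eq in auto)+
    ultimately show ?thesis
      unfolding interval_lebesgue_integrable_def by (simp split: if_splits)
  qed
  moreover have "set_integrable lborel (Q_region \<Omega>)
     (\<lambda>(x, y). \<bar>u t0 x - u t0 y\<bar>\<^sup>2 / norm (x - y) powr (real CARD('n) + 2 * s))"
    using leaf_finite_gagliardo[OF t0 s \<Omega>] by (simp add: finite_gagliardo_def)
  ultimately show ?thesis
    unfolding calib_well_defined_def
    using set_integrable_inner_integral set_integrable_reaction[OF F] trunc_integral_tendsto(3) by blast
qed

text \<open>
  The truncated integral is invariant under exchanging \<open>x\<close> and \<open>y\<close>, so twice its value is the integral
  of the symmetrized inner integral, to which the Young inequality applies pointwise. Truncation is
  needed here because the inner integrals alone need not be absolutely integrable near the diagonal.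
\<close>

lemma pv_le_gagliardo_difference:
  assumes fw: "finite_gagliardo s \<Omega> w"
  shows "(\<integral>x. pv_density x \<partial>lborel) \<le> (gagliardo s \<Omega> w - gagliardo s \<Omega> (u t0)) / 4"
proof -
  define q where "q v p = indicator (Q_region \<Omega>) p *\<^sub>R
     (case p of (x, y) \<Rightarrow> \<bar>v x - v y\<bar>\<^sup>2 / norm (x - y) powr (real CARD('n) + 2 * s))" for v p
  have qw: "integrable lborel (q w)" and qu: "integrable lborel (q (u t0))"
    using fw leaf_finite_gagliardo[OF t0 s \<Omega>]
    by (simp_all add: q_def[abs_def] finite_gagliardo_def set_integrable_def)
  define d where "d p = (q w p - q (u t0) p) / 4" for p
  have d: "integrable lborel d" using qw qu by (simp add: d_def[abs_def])
  have d_int: "(\<integral>p. d p \<partial>lborel) = (gagliardo s \<Omega> w - gagliardo s \<Omega> (u t0)) / 4"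
    using qw qu by (simp add: d_def gagliardo_def set_lebesgue_integral_def q_def[abs_def])
  define cut where "cut \<epsilon> p = (indicator {p. \<epsilon> \<le> norm (fst p - snd p)} p :: real)"
    for \<epsilon> and p :: "(real ^ 'n) \<times> (real ^ 'n)"
  have [measurable]: "cut \<epsilon> \<in> borel_measurable lborel" for \<epsilon>
    unfolding cut_def by (rule measurable_lborel_pair) measurable
  have [measurable]: "d \<in> borel_measurable lborel" using d by auto
  have cut_le: "\<bar>cut \<epsilon> p * d p\<bar> \<le> \<bar>d p\<bar>" for \<epsilon> p by (auto simp: cut_def indicator_def)
  have int_cut: "integrable lborel (\<lambda>p. cut \<epsilon> p * d p)" for \<epsilon>
    by (rule Bochner_Integration.integrable_bound[OF d]) (use cut_le in auto)
  have step: "trunc_integral s I \<Omega> u t0 w \<epsilon> \<le> (\<integral>p. cut \<epsilon> p * d p \<partial>lborel)" if \<epsilon>: "0 < \<epsilon>" for \<epsilon>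
  proof -
    let ?\<psi> = "\<lambda>(x, y). trunc_kernel \<epsilon> (x - y) * gap_mass x y"
    have \<psi>: "integrable lborel ?\<psi>" using integrable_gap_mass[OF \<epsilon>] .
    have swap: "integrable lborel (\<lambda>(x, y). ?\<psi> (y, x))"
      using lborel_pair.integrable_product_swap[of ?\<psi>] \<psi> by (simp add: lborel_prod)
    have "(\<integral>(x, y). ?\<psi> (y, x) \<partial>lborel) = (\<integral>p. ?\<psi> p \<partial>lborel)"
      using lborel_pair.integral_product_swap[of ?\<psi>] borel_measurable_integrable[OF \<psi>] by (simp add: lborel_prod)
    then have "2 * trunc_integral s I \<Omega> u t0 w \<epsilon> = (\<integral>p. ?\<psi> p \<partial>lborel) + (\<integral>(x, y). ?\<psi> (y, x) \<partial>lborel)"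
      by (simp add: trunc_integral_eq)
    also have "\<dots> = (\<integral>p. ?\<psi> p + (\<lambda>(x, y). ?\<psi> (y, x)) p \<partial>lborel)"
      using \<psi> swap by (intro Bochner_Integration.integral_add[symmetric])
    also have "\<dots> \<le> (\<integral>p. 2 * (cut \<epsilon> p * d p) \<partial>lborel)"
    proof (rule integral_mono)
      show "integrable lborel (\<lambda>p. ?\<psi> p + (\<lambda>(x, y). ?\<psi> (y, x)) p)"
        using \<psi> swap by (rule Bochner_Integration.integrable_add)
      show "integrable lborel (\<lambda>p. 2 * (cut \<epsilon> p * d p))" using int_cut by simp
      fix p :: "(real ^ 'n) \<times> (real ^ 'n)"
      obtain x y where p: "p = (x, y)" by (cases p)
      have "?\<psi> p + (\<lambda>(x, y). ?\<psi> (y, x)) p = trunc_kernel \<epsilon> (x - y) * (gap_mass x y + gap_mass y x)"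
        by (simp add: p trunc_kernel_minus[of \<epsilon> y x] distrib_left)
      also have "\<dots> \<le> trunc_kernel \<epsilon> (x - y) * ((\<bar>w x - w y\<bar>\<^sup>2 - \<bar>u t0 x - u t0 y\<bar>\<^sup>2) / 2)"
        by (intro mult_left_mono gap_mass_young trunc_kernel_nonneg)
      also have "\<dots> = 2 * (cut \<epsilon> p * d p)"
      proof (cases "p \<in> Q_region \<Omega>")
        case True
        then show ?thesis
          by (simp add: p d_def q_def cut_def trunc_kernel_def indicator_def diff_divide_distrib)
      next
        case False
        then have "w x = u t0 x" "w y = u t0 y" using w_exterior by (auto simp: p Q_region_def)
        then show ?thesis using False by (simp add: d_def q_def)
      qed
      finally show "?\<psi> p + (\<lambda>(x, y). ?\<psi> (y, x)) p \<le> 2 * (cut \<epsilon> p * d p)" .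
    qed
    finally show ?thesis by simp
  qed
  have lim: "((\<lambda>\<epsilon>. cut \<epsilon> p * d p) \<longlongrightarrow> d p) (at_right 0)" for p
  proof (cases "fst p = snd p")
    case True
    then show ?thesis by (cases p) (simp add: d_def q_def)
  next
    case False
    then have "\<forall>\<^sub>F \<epsilon> in at_right 0. \<epsilon> < norm (fst p - snd p)"
      by (intro eventually_at_rightI[of 0 "norm (fst p - snd p)"]) auto
    then have "\<forall>\<^sub>F \<epsilon> in at_right 0. d p = cut \<epsilon> p * d p"
      by eventually_elim (simp add: cut_def)
    then show ?thesis by (rule Lim_transform_eventually[OF tendsto_const])
  qed
  have "((\<lambda>\<epsilon>. \<integral>p. cut \<epsilon> p * d p \<partial>lborel) \<longlongrightarrow> (\<integral>p. d p \<partial>lborel)) (at_right 0)"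
    by (rule dominated_at_right_zero(2)[OF _ lim cut_le]) (use d in auto)
  from tendsto_le[OF _ this trunc_integral_tendsto(3)]
  have "(\<integral>x. pv_density x \<partial>lborel) \<le> (\<integral>p. d p \<partial>lborel)"
    by (auto intro: eventually_mono[OF eventually_at_right_less] step)
  then show ?thesis by (simp add: d_int)
qed

text \<open>
  For a competitor of infinite Gagliardo energy the right-hand side is infinite and there is nothing
  to compare.
\<close>

lemma calib_functional_le_energy:
  assumes "0 < c"
  shows "ereal (calib_functional c s F I \<Omega> u t0 w) \<le> energy c s F \<Omega> w"
proof (cases "finite_gagliardo s \<Omega> w")
  case True
  from mult_left_mono[OF pv_le_gagliardo_difference[OF True], of c] assms
  have "c * (\<integral>x. pv_density x \<partial>lborel) \<le> c / 4 * gagliardo s \<Omega> w - c / 4 * gagliardo s \<Omega> (u t0)"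
    by (simp add: field_simps)
  then show ?thesis by (simp add: energy_finite[OF True] calib_functional_eq)
next
  case False
  then show ?thesis by (simp add: energy_infinite[OF measurable_w \<Omega>_measurable assms])
qed

lemma pv_density_scale:
  "c * pv_density x = (\<integral>l. layer x l * frac_laplacian c s (u (leaf_param I u x l)) x \<partial>lborel)"
  unfolding pv_density_def frac_laplacian_scale[of c] by (simp add: mult.left_commute)

lemma reaction_difference:
  assumes F: "F C1_differentiable_on UNIV"
  shows "integrable lborel (\<lambda>l. layer x l * deriv F l)"
    and "F (w x) - F (u t0 x) = (\<integral>l. layer x l * deriv F l \<partial>lborel)"
proof -
  obtain D where D: "\<And>l. (F has_vector_derivative D l) (at l)" and c: "continuous_on UNIV D"
    using F unfolding C1_differentiable_on_def by blast
  have dF: "deriv F = D"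
    using D[folded has_real_derivative_iff_has_vector_derivative] by (intro ext DERIV_imp_deriv)
  have [measurable]: "D \<in> borel_measurable borel" using c by (rule borel_measurable_continuous_onI)
  obtain M where M: "\<And>l. l \<in> {-K..K} \<Longrightarrow> \<bar>D l\<bar> \<le> M"
    using compact_imp_bounded[OF compact_continuous_image[OF continuous_on_subset[OF c subset_UNIV], of "{-K..K}"]]
    unfolding bounded_iff real_norm_def by blast
  show "integrable lborel (\<lambda>l. layer x l * deriv F l)"
    unfolding dF
  proof (rule Bochner_Integration.integrable_bound[OF integrable_box[of M]])
    show "AE l in lborel. norm (layer x l * D l) \<le> norm (M * indicator {-K..K} l)"
    proof (rule AE_I2)
      fix l
      show "norm (layer x l * D l) \<le> norm (M * indicator {-K..K} l)"
      proof (cases "layer x l = 0")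
        case False
        note l = layer_nonzero(2)[OF False]
        have "\<bar>layer x l\<bar> * \<bar>D l\<bar> \<le> 1 * \<bar>M\<bar>"
          using layer_abs_le M[OF l] by (intro mult_mono) auto
        then show ?thesis using l by (simp add: abs_mult)
      qed simp
    qed
  qed measurable
  show "F (w x) - F (u t0 x) = (\<integral>l. layer x l * deriv F l \<partial>lborel)"
    unfolding dF interval_integral_eq_layer[symmetric]
    by (rule interval_integral_FTC_finite[symmetric])
       (auto intro: continuous_on_subset[OF c] has_vector_derivative_at_within[OF D])
qed

text \<open>
  Both the principal value and \<open>F (w x) - F (u t0 x)\<close> are integrals over the same layer, the latter by
  the fundamental theorem of calculus, and the Gagliardo term of \<open>u t0\<close> cancels.
\<close>

lemma calib_functional_minus_base:
  assumes F: "F C1_differentiable_on UNIV"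
  shows "calib_functional c s F I \<Omega> u t0 w - calib_functional c s F I \<Omega> u t0 (u t0)
    = (\<integral>x. \<integral>l. layer x l * (frac_laplacian c s (u (leaf_param I u x l)) x - deriv F l) \<partial>lborel \<partial>lborel)"
proof -
  have cF: "continuous_on UNIV F" using C1_differentiable_imp_continuous_on[OF F] .
  interpret base: field_competitor I u K \<Omega> s t0 "u t0"
    using \<Omega> s t0 leaf_admissible by unfold_locales (auto simp: same_dirichlet_def)
  note int = set_integrable_reaction[OF cF, unfolded set_integrable_def]
    base.set_integrable_reaction[OF cF, unfolded set_integrable_def]
  have "(\<integral>l. layer x l * (frac_laplacian c s (u (leaf_param I u x l)) x - deriv F l) \<partial>lborel)
      = c * pv_density x - (indicator \<Omega> x *\<^sub>R F (w x) - indicator \<Omega> x *\<^sub>R F (u t0 x))" for x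
  proof -
    have "integrable lborel (\<lambda>l. layer x l * frac_laplacian c s (u (leaf_param I u x l)) x)"
      using integrable_mult_right[OF trunc_integral_tendsto(1), of c x]
      unfolding frac_laplacian_scale[of c] by (simp add: mult.left_commute)
    then have "(\<integral>l. layer x l * (frac_laplacian c s (u (leaf_param I u x l)) x - deriv F l) \<partial>lborel)
      = c * pv_density x - (F (w x) - F (u t0 x))"
      unfolding pv_density_scale reaction_difference(2)[OF F] right_diff_distrib
      using reaction_difference(1)[OF F] by (rule Bochner_Integration.integral_diff)
    then show ?thesis using w_exterior[of x] by (cases "x \<in> \<Omega>") auto
  qed
  then show ?thesis
    unfolding calib_functional_eq calib_functional_base set_lebesgue_integral_def
    using trunc_integral_tendsto(2) int by simp
qed

text \<open>
  Where \<open>w\<close> is above \<open>u t0\<close> the layer is positive and only leaves with \<open>t \<ge> t0\<close> are met; where \<open>w\<close> is below, the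
  layer is negative and only leaves with \<open>t \<le> t0\<close> are met. In both cases the integrand is nonnegative.
\<close>

lemma calib_functional_ge_base:
  assumes F: "F C1_differentiable_on UNIV"
    and super: "\<And>t x. t \<in> I \<Longrightarrow> x \<in> \<Omega> \<Longrightarrow> t0 \<le> t \<Longrightarrow> 0 \<le> frac_laplacian c s (u t) x - deriv F (u t x)"
    and sub: "\<And>t x. t \<in> I \<Longrightarrow> x \<in> \<Omega> \<Longrightarrow> t \<le> t0 \<Longrightarrow> frac_laplacian c s (u t) x - deriv F (u t x) \<le> 0"
  shows "calib_functional c s F I \<Omega> u t0 (u t0) \<le> calib_functional c s F I \<Omega> u t0 w"
proof -
  have "0 \<le> layer x l * (frac_laplacian c s (u (leaf_param I u x l)) x - deriv F l)" for x l
  proof (cases "layer x l = 0")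
    case False
    note n = layer_nonzero[OF False] and t = leaf_param[OF layer_nonzero(3)[OF False]]
    from layer_nonzero_between[OF False] show ?thesis
    proof
      assume l: "u t0 x < l \<and> l < w x"
      then have "t0 \<le> leaf_param I u x l" using le_iff[OF t0 t(1), of x] t(2) by simp
      then show ?thesis using super[OF t(1) n(1)] t(2) l by (simp add: layer_def)
    next
      assume l: "w x < l \<and> l < u t0 x"
      then have "leaf_param I u x l \<le> t0" using le_iff[OF t(1) t0, of x] t(2) by simp
      then show ?thesis using sub[OF t(1) n(1)] t(2) l by (simp add: layer_def)
    qed
  qed simp
  then have "0 \<le> calib_functional c s F I \<Omega> u t0 w - calib_functional c s F I \<Omega> u t0 (u t0)"
    unfolding calib_functional_minus_base[OF F] by (intro Bochner_Integration.integral_nonneg) auto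
  then show ?thesis by simp
qed

lemma calib_functional_eq_base:
  assumes F: "F C1_differentiable_on UNIV"
    and extremal: "\<And>t x. t \<in> I \<Longrightarrow> x \<in> \<Omega> \<Longrightarrow> frac_laplacian c s (u t) x - deriv F (u t x) = 0"
  shows "calib_functional c s F I \<Omega> u t0 w = calib_functional c s F I \<Omega> u t0 (u t0)"
proof -
  have zero: "layer x l * (frac_laplacian c s (u (leaf_param I u x l)) x - deriv F l) = 0" for x l
  proof (cases "layer x l = 0")
    case False
    then show ?thesis
      using extremal[OF leaf_param(1) layer_nonzero(1), of x l x l] leaf_param(2) layer_nonzero(3) by simp
  qed simp
  have "calib_functional c s F I \<Omega> u t0 w - calib_functional c s F I \<Omega> u t0 (u t0) = 0"
    unfolding calib_functional_minus_base[OF F] zero by simp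
  then show ?thesis by simp
qed

end

section \<open>Calibration and minimality\<close>

theorem theorem1p3:
  fixes I :: "real set" and \<Omega> :: "(real ^ 'n) set" and s c t0 K :: real
    and u :: "real \<Rightarrow> real ^ 'n \<Rightarrow> real" and F :: "real \<Rightarrow> real"
  assumes "is_interval I"
    and "open \<Omega>" and "connected \<Omega>" and "bounded \<Omega>" and "\<Omega> \<noteq> {}"
    and "0 < s" and "s < 1"
    and "0 < c"
    and "C2_field I u"
    and "\<forall>x. \<forall>t\<in>I. \<bar>u t x\<bar> + \<bar>vector_derivative (\<lambda>\<tau>. u \<tau> x) (at t within I)\<bar> \<le> K"
    and "t0 \<in> I"
    and "F C1_differentiable_on UNIV"
  shows
    "(\<forall>w\<in>admissible I u. same_dirichlet \<Omega> w (u t0) \<longrightarrow> calib_well_defined s F I \<Omega> u t0 w)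
     \<and>
     \<comment> \<open>(a)\<close>
     (ereal (calib_functional c s F I \<Omega> u t0 (u t0)) = energy c s F \<Omega> (u t0) \<and>
      (\<forall>w\<in>admissible I u. same_dirichlet \<Omega> w (u t0) \<longrightarrow>
         ereal (calib_functional c s F I \<Omega> u t0 w) \<le> energy c s F \<Omega> w))
     \<and>
     \<comment> \<open>(b)\<close>
     ((\<forall>t\<in>I. \<forall>x\<in>\<Omega>.
         (t0 \<le> t \<longrightarrow> frac_laplacian c s (u t) x - deriv F (u t x) \<ge> 0) \<and>
         (t \<le> t0 \<longrightarrow> frac_laplacian c s (u t) x - deriv F (u t x) \<le> 0)) \<longrightarrow>
       (\<forall>w\<in>admissible I u. same_dirichlet \<Omega> w (u t0) \<longrightarrow>
          calib_functional c s F I \<Omega> u t0 (u t0) \<le> calib_functional c s F I \<Omega> u t0 w) \<and>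
       is_arg_min (energy c s F \<Omega>) (\<lambda>w. w \<in> admissible I u \<and> same_dirichlet \<Omega> w (u t0)) (u t0))
     \<and>
     \<comment> \<open>(c)\<close>
     ((\<forall>t\<in>I. \<forall>x\<in>\<Omega>. frac_laplacian c s (u t) x - deriv F (u t x) = 0) \<longrightarrow>
       (\<forall>w\<in>admissible I u. \<forall>w'\<in>admissible I u.
          same_dirichlet \<Omega> w (u t0) \<longrightarrow> same_dirichlet \<Omega> w' (u t0) \<longrightarrow>
          calib_functional c s F I \<Omega> u t0 w = calib_functional c s F I \<Omega> u t0 w') \<and>
       is_calibration \<Omega> (admissible I u) (energy c s F \<Omega>) (u t0) (calib_functional c s F I \<Omega> u t0) \<and>
       (\<forall>t\<in>I. is_arg_min (energy c s F \<Omega>)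
          (\<lambda>w. w \<in> admissible I u \<and> same_dirichlet \<Omega> w (u t)) (u t)))"
proof -
  note \<Omega> = \<open>open \<Omega>\<close> \<open>bounded \<Omega>\<close> and s = \<open>0 < s\<close> \<open>s < 1\<close> and F = \<open>F C1_differentiable_on UNIV\<close>
  interpret bounded_field I u K
  proof
    show "\<bar>u t x\<bar> \<le> K" if "t \<in> I" for t x
      using assms(10) that abs_ge_zero[of "vector_derivative (\<lambda>\<tau>. u \<tau> x) (at t within I)"]
      by (smt (verit))
  qed (use assms in auto)
  have cF: "continuous_on UNIV F" using C1_differentiable_imp_continuous_on[OF F] .
  have competitor: "field_competitor I u K \<Omega> s t w"
    if "t \<in> I" "w \<in> admissible I u" "same_dirichlet \<Omega> w (u t)" for t w
    using \<Omega> s that by unfold_locales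
  have base: "ereal (calib_functional c s F I \<Omega> u t (u t)) = energy c s F \<Omega> (u t)" if "t \<in> I" for t
    using energy_finite[OF leaf_finite_gagliardo[OF that s \<Omega>]] by (simp add: calib_functional_base)
  have upper: "ereal (calib_functional c s F I \<Omega> u t w) \<le> energy c s F \<Omega> w"
    if "t \<in> I" "w \<in> admissible I u" "same_dirichlet \<Omega> w (u t)" for t w
    using field_competitor.calib_functional_le_energy[OF competitor[OF that] \<open>0 < c\<close>] .
  \<comment> \<open>A lower bound for the calibration based at \<open>u t\<close> passes to the energy; the base leaf is kept arbitrary because for a field of extremals every leaf may serve as one.\<close>
  have minimizer: "is_arg_min (energy c s F \<Omega>) (\<lambda>w. w \<in> admissible I u \<and> same_dirichlet \<Omega> w (u t)) (u t)"
    if t: "t \<in> I" and ge: "\<And>w. w \<in> admissible I u \<Longrightarrow> same_dirichlet \<Omega> w (u t) \<Longrightarrow>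
      calib_functional c s F I \<Omega> u t (u t) \<le> calib_functional c s F I \<Omega> u t w" for t
    unfolding is_arg_min_linorder
  proof (intro conjI allI impI)
    show "u t \<in> admissible I u" "same_dirichlet \<Omega> (u t) (u t)"
      using leaf_admissible[OF t] by (simp_all add: same_dirichlet_def)
    fix w assume w: "w \<in> admissible I u \<and> same_dirichlet \<Omega> w (u t)"
    have "energy c s F \<Omega> (u t) = ereal (calib_functional c s F I \<Omega> u t (u t))" using base[OF t] by simp
    also have "\<dots> \<le> ereal (calib_functional c s F I \<Omega> u t w)" using ge w by simp
    also have "\<dots> \<le> energy c s F \<Omega> w" using upper[OF t] w by simp
    finally show "energy c s F \<Omega> (u t) \<le> energy c s F \<Omega> w" .
  qed
  have partb: "(\<forall>w\<in>admissible I u. same_dirichlet \<Omega> w (u t0) \<longrightarrow>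
          calib_functional c s F I \<Omega> u t0 (u t0) \<le> calib_functional c s F I \<Omega> u t0 w) \<and>
       is_arg_min (energy c s F \<Omega>) (\<lambda>w. w \<in> admissible I u \<and> same_dirichlet \<Omega> w (u t0)) (u t0)"
    if signs: "\<forall>t\<in>I. \<forall>x\<in>\<Omega>.
         (t0 \<le> t \<longrightarrow> frac_laplacian c s (u t) x - deriv F (u t x) \<ge> 0) \<and>
         (t \<le> t0 \<longrightarrow> frac_laplacian c s (u t) x - deriv F (u t x) \<le> 0)"
  proof -
    have "calib_functional c s F I \<Omega> u t0 (u t0) \<le> calib_functional c s F I \<Omega> u t0 w"
      if w: "w \<in> admissible I u" "same_dirichlet \<Omega> w (u t0)" for w
      by (rule field_competitor.calib_functional_ge_base[OF competitor[OF \<open>t0 \<in> I\<close> w] F])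
         (use signs in blast)+
    then show ?thesis using minimizer[OF \<open>t0 \<in> I\<close>] by blast
  qed
  have partc: "(\<forall>w\<in>admissible I u. \<forall>w'\<in>admissible I u.
          same_dirichlet \<Omega> w (u t0) \<longrightarrow> same_dirichlet \<Omega> w' (u t0) \<longrightarrow>
          calib_functional c s F I \<Omega> u t0 w = calib_functional c s F I \<Omega> u t0 w') \<and>
       is_calibration \<Omega> (admissible I u) (energy c s F \<Omega>) (u t0) (calib_functional c s F I \<Omega> u t0) \<and>
       (\<forall>t\<in>I. is_arg_min (energy c s F \<Omega>)
          (\<lambda>w. w \<in> admissible I u \<and> same_dirichlet \<Omega> w (u t)) (u t))"
    if ext: "\<forall>t\<in>I. \<forall>x\<in>\<Omega>. frac_laplacian c s (u t) x - deriv F (u t x) = 0"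
  proof -
    have eq: "calib_functional c s F I \<Omega> u t w = calib_functional c s F I \<Omega> u t (u t)"
      if "t \<in> I" "w \<in> admissible I u" "same_dirichlet \<Omega> w (u t)" for t w
      by (rule field_competitor.calib_functional_eq_base[OF competitor[OF that] F]) (use ext in blast)
    have all: "\<forall>w\<in>admissible I u. \<forall>w'\<in>admissible I u.
          same_dirichlet \<Omega> w (u t0) \<longrightarrow> same_dirichlet \<Omega> w' (u t0) \<longrightarrow>
          calib_functional c s F I \<Omega> u t0 w = calib_functional c s F I \<Omega> u t0 w'"
      using eq[OF \<open>t0 \<in> I\<close>] by simp
    have "\<forall>t\<in>I. is_arg_min (energy c s F \<Omega>)
          (\<lambda>w. w \<in> admissible I u \<and> same_dirichlet \<Omega> w (u t)) (u t)"
      using minimizer eq by simp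
    moreover have "is_calibration \<Omega> (admissible I u) (energy c s F \<Omega>) (u t0) (calib_functional c s F I \<Omega> u t0)"
      unfolding is_calibration_def
      using all base[OF \<open>t0 \<in> I\<close>] upper[OF \<open>t0 \<in> I\<close>] leaf_admissible[OF \<open>t0 \<in> I\<close>] by blast
    ultimately show ?thesis using all by blast
  qed
  have wd: "\<forall>w\<in>admissible I u. same_dirichlet \<Omega> w (u t0) \<longrightarrow> calib_well_defined s F I \<Omega> u t0 w"
    using field_competitor.calib_well_defined[OF competitor[OF \<open>t0 \<in> I\<close>] cF] by blast
  show ?thesis
    by (intro conjI wd impI[OF partb] impI[OF partc] base[OF \<open>t0 \<in> I\<close>])
       (use upper[OF \<open>t0 \<in> I\<close>] in blast)
qed

end
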